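(* For $\lambda\in\rho(\mathbb{A}_0)$ the equivalences $$\lambda\in\sigma(\mathcal{A})\iff\lambda\in\sigma(\mathbb{B}_\lambda)\qquad\text{and}\qquad\lambda\in P\sigma(\mathcal{A})\iff\lambda\in P\sigma(\mathbb{B}_\lambda)$$ hold. The set $\Gamma:=\{\lambda\in\mathbb{C}:\lambda\in\rho(\mathbb{A}_0)\cap\rho(\mathbb{B}_\lambda)\}\subset\rho(\mathcal{A})$ is nonempty, and for $\lambda\in\Gamma$ the resolvent operator of $\mathcal{A}$ is given by $$R(\lambda,\mathcal{A})=\begin{pmatrix}R(\lambda,\mathbb{A}_0)+\mathbb{D}_\lambda R(\lambda,\mathbb{B}_\lambda)\mathbb{B}R(\lambda,\mathbb{A}_0) & \mathbb{D}_\lambda R(\lambda,\mathbb{B}_\lambda)\\ R(\lambda,\mathbb{B}_\lambda)\mathbb{B}R(\lambda,\mathbb{A}_0) & R(\lambda,\mathbb{B}_\lambda)\end{pmatrix}.$$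
   Context: Standing assumptions: $X$, $Y$, $\partial X$ are Banach spaces ($\partial X$ is just the name of a third Banach space) with $Y\hookrightarrow X$ (continuous embedding). $A:D(A)\to X$ is linear with $D(A)\subset Y$; $R:D(A)\to\partial X$ is linear and surjective; $B_1,B_2\in\mathcal{L}(Y,\partial X)$; $B_3,B_4\in\mathcal{L}(\partial X)$; the operator $\binom{A}{R}:D(A)\subset Y\to X\times\partial X$, $u\mapsto(Au,Ru)$, is closed; the restriction $A_0:=A|_{\ker R}$ generates a cosine operator function with associated phase space $Y\times X$ (i.e. the operator matrix $\begin{pmatrix} 0 & I_Y \\ A_0 & 0 \end{pmatrix}$ with domain $D(A_0)\times Y$ generates a strongly continuous group on $Y\times X$). Put $L:=R+B_2:D(A)\to\partial X$. Let $\mathbb{X}=Y\times X\times\partial X$, $\partial\mathbb{X}=\partial X$, and $$\mathbb{A}=\begin{pmatrix} 0 & I_Y & 0 \\ A & 0 & 0 \\ L & 0 & 0 \end{pmatrix},\ D(\mathbb{A})=D(A)\times Y\times\partial X,\qquad \mathcal{R}=(R\ \ 0\ \ 0):D(\mathbb{A})\to\partial\mathbb{X},$$ $\mathbb{B}=(B_1+B_4B_2\ \ 0\ \ B_3):\mathbb{X}\to\partial\mathbb{X}$, $\tilde{\mathbb{B}}=B_4$ on $\partial\mathbb{X}$, and $\mathbb{A}_0:=\mathbb{A}|_{\ker\mathcal{R}}$, i.e. $\mathbb{A}_0(u,v,x)=(v,A_0u,B_2u)$ with $D(\mathbb{A}_0)=D(A_0)\times Y\times\partial X$. On $\mathcal{X}=\mathbb{X}\times\partial\mathbb{X}$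 let $$\mathcal{A}=\begin{pmatrix}\mathbb{A}&0\\ \mathbb{B}&\tilde{\mathbb{B}}\end{pmatrix},\qquad D(\mathcal{A})=\{(\mathbf u,\mathbf x)\in D(\mathbb{A})\times\partial\mathbb{X}:\mathcal{R}\mathbf u=\mathbf x\}.$$ For $\mu\in\rho(A_0)$, $D_\mu^{A,R}:\partial X\to\ker(\mu-A)$ denotes the (bounded) inverse of $R|_{\ker(\mu-A)}$. One has $\rho(\mathbb{A}_0)=\{\lambda\neq0:\lambda^2\in\rho(A_0)\}$; for $\lambda\in\rho(\mathbb{A}_0)$, $\mathbb{D}_\lambda:\partial\mathbb{X}\to\ker(\lambda-\mathbb{A})$ is the inverse of $\mathcal{R}|_{\ker(\lambda-\mathbb{A})}$, given by $\mathbb{D}_\lambda y=(D_{\lambda^2}^{A,R}y,\ \lambda D_{\lambda^2}^{A,R}y,\ \frac1\lambda LD_{\lambda^2}^{A,R}y)$, and $$\mathbb{B}_\lambda:=\tilde{\mathbb{B}}+\mathbb{B}\mathbb{D}_\lambda=B_1D_{\lambda^2}^{A,R}+\left(\tfrac1\lambda B_3+B_4\right)LD_{\lambda^2}^{A,R}\in\mathcal{L}(\partial X).$$ $R(\lambda,T)=(\lambda-T)^{-1}$; $\sigma,P\sigma,\rho$ denote spectrum, point spectrum (eigenvalues) and resolvent set. *)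

theory Defs
  imports "HOL-Analysis.Analysis"
begin

text \<open>HOL-Analysis only has real Banach spaces; spectral theory needs complex scalars.\<close>

class complex_normed_vector = real_normed_vector +
  fixes scaleC :: "complex \<Rightarrow> 'a \<Rightarrow> 'a"  (infixr \<open>*\<^sub>C\<close> 75)
  assumes scaleC_add_right: "a *\<^sub>C (x + y) = a *\<^sub>C x + a *\<^sub>C y"
    and scaleC_add_left: "(a + b) *\<^sub>C x = a *\<^sub>C x + b *\<^sub>C x"
    and scaleC_scaleC: "a *\<^sub>C (b *\<^sub>C x) = (a * b) *\<^sub>C x"
    and scaleC_of_real: "complex_of_real r *\<^sub>C x = r *\<^sub>R x"
    and norm_scaleC: "norm (a *\<^sub>C x) = cmod a * norm x"

class complex_banach = complex_normed_vector + banach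

instantiation complex :: complex_normed_vector
begin
definition scaleC_complex_def: "a *\<^sub>C (x :: complex) = a * x"
instance
  by standard (simp_all add: scaleC_complex_def algebra_simps norm_mult scaleR_conv_of_real)
end

instance complex :: complex_banach ..

instantiation prod :: (complex_normed_vector, complex_normed_vector) complex_normed_vector
begin
definition scaleC_prod_def: "a *\<^sub>C p = (a *\<^sub>C fst p, a *\<^sub>C snd p)"
instance
proof
  fix a b :: complex and r :: real and x y :: "'a \<times> 'b"
  show "a *\<^sub>C (x + y) = a *\<^sub>C x + a *\<^sub>C y"
    by (simp add: scaleC_prod_def scaleC_add_right)
  show "(a + b) *\<^sub>C x = a *\<^sub>C x + b *\<^sub>C x"
    by (simp add: scaleC_prod_def scaleC_add_left)
  show "a *\<^sub>C (b *\<^sub>C x) = (a * b) *\<^sub>C x"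
    by (simp add: scaleC_prod_def scaleC_scaleC)
  show "complex_of_real r *\<^sub>C x = r *\<^sub>R x"
    by (simp add: scaleC_prod_def scaleC_of_real scaleR_prod_def)
  show "norm (a *\<^sub>C x) = cmod a * norm x"
    by (simp add: scaleC_prod_def norm_prod_def norm_scaleC power_mult_distrib
        flip: distrib_left) (simp add: real_sqrt_mult)
qed
end

instance prod :: (complex_banach, complex_banach) complex_banach ..

definition bounded_clinear :: "('a::complex_normed_vector \<Rightarrow> 'b::complex_normed_vector) \<Rightarrow> bool"
  where "bounded_clinear f \<longleftrightarrow> bounded_linear f \<and> (\<forall>c x. f (c *\<^sub>C x) = c *\<^sub>C f x)"

definition csubspace :: "'a::complex_normed_vector set \<Rightarrow> bool"
  where "csubspace S \<longleftrightarrow> 0 \<in> S \<and> (\<forall>x\<in>S. \<forall>y\<in>S. x + y \<in> S) \<and> (\<forall>c. \<forall>x\<in>S. c *\<^sub>C x \<in> S)"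

definition clinear_on ::
    "'a::complex_normed_vector set \<Rightarrow> ('a \<Rightarrow> 'b::complex_normed_vector) \<Rightarrow> bool"
  where "clinear_on S f \<longleftrightarrow> csubspace S \<and>
    (\<forall>x\<in>S. \<forall>y\<in>S. f (x + y) = f x + f y) \<and> (\<forall>c. \<forall>x\<in>S. f (c *\<^sub>C x) = c *\<^sub>C f x)"

text \<open>A partially defined operator; the values of \<open>op_fun\<close> outside \<open>op_dom\<close> carry no meaning.\<close>

datatype ('a, 'b) partial_op = Op (op_dom: "'a set") (op_fun: "'a \<Rightarrow> 'b")

definition closed_op ::
    "('a::topological_space, 'b::topological_space) partial_op \<Rightarrow> bool"
  where "closed_op T \<longleftrightarrow> closed {(x, op_fun T x) | x. x \<in> op_dom T}"

definition restrict_ker :: "('a, 'b) partial_op \<Rightarrow> ('a \<Rightarrow> 'c::zero) \<Rightarrow> ('a, 'b) partial_op"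
  where "restrict_ker T R = Op {x \<in> op_dom T. R x = 0} (op_fun T)"

abbreviation total_op :: "('a \<Rightarrow> 'b) \<Rightarrow> ('a, 'b) partial_op"
  where "total_op f \<equiv> Op UNIV f"

text \<open>\<open>resolvent T \<mu>\<close> is meaningful only for \<open>\<mu>\<close> in the resolvent set.\<close>

definition resolvent :: "('a::complex_banach, 'a) partial_op \<Rightarrow> complex \<Rightarrow> 'a \<Rightarrow> 'a"
  where "resolvent T \<mu> = the_inv_into (op_dom T) (\<lambda>x. \<mu> *\<^sub>C x - op_fun T x)"

definition resolvent_set :: "('a::complex_banach, 'a) partial_op \<Rightarrow> complex set"
  where "resolvent_set T = {\<mu>. bij_betw (\<lambda>x. \<mu> *\<^sub>C x - op_fun T x) (op_dom T) UNIV \<and>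
    bounded_clinear (resolvent T \<mu>)}"

definition spectrum :: "('a::complex_banach, 'a) partial_op \<Rightarrow> complex set"
  where "spectrum T = - resolvent_set T"

definition point_spectrum :: "('a::complex_banach, 'a) partial_op \<Rightarrow> complex set"
  where "point_spectrum T = {\<mu>. \<exists>x \<in> op_dom T. x \<noteq> 0 \<and> op_fun T x = \<mu> *\<^sub>C x}"

text \<open>The inverse of the restriction of \<open>R\<close> to \<open>ker (\<mu> - T)\<close>.\<close>

definition dirichlet_op ::
    "('a::complex_banach, 'a) partial_op \<Rightarrow> ('a \<Rightarrow> 'b) \<Rightarrow> complex \<Rightarrow> 'b \<Rightarrow> 'a"
  where "dirichlet_op T R \<mu> = the_inv_into {u \<in> op_dom T. \<mu> *\<^sub>C u - op_fun T u = 0} R"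

definition C0_group :: "(real \<Rightarrow> 'a::complex_banach \<Rightarrow> 'a) \<Rightarrow> bool"
  where "C0_group U \<longleftrightarrow> (\<forall>t. bounded_clinear (U t)) \<and> U 0 = id \<and>
    (\<forall>s t. U (s + t) = U s \<circ> U t) \<and> (\<forall>x. continuous_on UNIV (\<lambda>t. U t x))"

definition generates_C0_group :: "('a::complex_banach, 'a) partial_op \<Rightarrow> bool"
  where "generates_C0_group T \<longleftrightarrow> (\<exists>U. C0_group U \<and>
    op_dom T = {x. \<exists>y. ((\<lambda>h. (U h x - x) /\<^sub>R h) \<longlongrightarrow> y) (at 0)} \<and>
    (\<forall>x \<in> op_dom T. ((\<lambda>h. (U h x - x) /\<^sub>R h) \<longlongrightarrow> op_fun T x) (at 0)))"

text \<open>The continuous embedding of \<open>Y\<close> into \<open>X\<close> is an injective bounded map \<open>j\<close>. Hence an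
  element \<open>w\<close> of \<open>X\<close> lies in \<open>Y\<close> iff it is in \<open>range j\<close>, and it is then \<open>inv j w\<close> as an element
  of \<open>Y\<close>. In particular the operator matrix with rows \<open>(0, I\<^sub>Y)\<close> and \<open>(A\<^sub>0, 0)\<close> is the following
  operator on \<open>Y \<times> X\<close>.\<close>

definition phase_space_op ::
    "('y \<Rightarrow> 'x) \<Rightarrow> ('y, 'x) partial_op \<Rightarrow> ('y \<times> 'x, 'y \<times> 'x) partial_op"
  where "phase_space_op j A0 =
    Op (op_dom A0 \<times> range j) (\<lambda>(u, w). (inv j w, op_fun A0 u))"

definition generates_cosine_function ::
    "('y::complex_banach \<Rightarrow> 'x::complex_banach) \<Rightarrow> ('y, 'x) partial_op \<Rightarrow> bool"
  where "generates_cosine_function j A0 \<longleftrightarrow> generates_C0_group (phase_space_op j A0)"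

definition block_op ::
    "('a \<Rightarrow> 'c::plus) \<Rightarrow> ('b \<Rightarrow> 'c) \<Rightarrow> ('a \<Rightarrow> 'd::plus) \<Rightarrow> ('b \<Rightarrow> 'd) \<Rightarrow> 'a \<times> 'b \<Rightarrow> 'c \<times> 'd"
  where "block_op P Q S T = (\<lambda>(x, y). (P x + Q y, S x + T y))"

text \<open>The operators on \<open>Y \<times> X \<times> \<partial>X\<close> (prefix \<open>bb\<close> for blackboard bold) and the operator
  \<open>cal_A\<close> on \<open>(Y \<times> X \<times> \<partial>X) \<times> \<partial>X\<close>; \<open>R u + B2 u\<close> is \<open>L u\<close>.\<close>

definition bb_A ::
    "('y \<Rightarrow> 'x) \<Rightarrow> ('y, 'x) partial_op \<Rightarrow> ('y \<Rightarrow> 'd::plus) \<Rightarrow> ('y \<Rightarrow> 'd)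
      \<Rightarrow> ('y \<times> 'x \<times> 'd, 'y \<times> 'x \<times> 'd) partial_op"
  where "bb_A j A R B2 =
    Op (op_dom A \<times> range j \<times> UNIV) (\<lambda>(u, w, x). (inv j w, op_fun A u, R u + B2 u))"

definition bb_R :: "('y \<Rightarrow> 'd) \<Rightarrow> 'y \<times> 'x \<times> 'd \<Rightarrow> 'd"
  where "bb_R R = (\<lambda>(u, w, x). R u)"

definition bb_B ::
    "('y \<Rightarrow> 'd::plus) \<Rightarrow> ('y \<Rightarrow> 'd) \<Rightarrow> ('d \<Rightarrow> 'd) \<Rightarrow> ('d \<Rightarrow> 'd) \<Rightarrow> 'y \<times> 'x \<times> 'd \<Rightarrow> 'd"
  where "bb_B B1 B2 B3 B4 = (\<lambda>(u, w, x). (B1 u + B4 (B2 u)) + B3 x)"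

definition bb_A0 ::
    "('y \<Rightarrow> 'x) \<Rightarrow> ('y, 'x) partial_op \<Rightarrow> ('y \<Rightarrow> 'd::monoid_add) \<Rightarrow> ('y \<Rightarrow> 'd)
      \<Rightarrow> ('y \<times> 'x \<times> 'd, 'y \<times> 'x \<times> 'd) partial_op"
  where "bb_A0 j A R B2 = restrict_ker (bb_A j A R B2) (bb_R R)"

definition cal_A ::
    "('y::monoid_add \<Rightarrow> 'x::monoid_add) \<Rightarrow> ('y, 'x) partial_op \<Rightarrow> ('y \<Rightarrow> 'd::monoid_add)
      \<Rightarrow> ('y \<Rightarrow> 'd) \<Rightarrow> ('y \<Rightarrow> 'd) \<Rightarrow> ('d \<Rightarrow> 'd) \<Rightarrow> ('d \<Rightarrow> 'd)
      \<Rightarrow> (('y \<times> 'x \<times> 'd) \<times> 'd, ('y \<times> 'x \<times> 'd) \<times> 'd) partial_op"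
  where "cal_A j A R B1 B2 B3 B4 =
    Op {(u, x). u \<in> op_dom (bb_A j A R B2) \<and> bb_R R u = x}
       (block_op (op_fun (bb_A j A R B2)) (\<lambda>_. 0) (bb_B B1 B2 B3 B4) B4)"

definition bb_D ::
    "('y::complex_banach \<Rightarrow> 'x::complex_banach) \<Rightarrow> ('y, 'x) partial_op
      \<Rightarrow> ('y \<Rightarrow> 'd::complex_banach) \<Rightarrow> ('y \<Rightarrow> 'd) \<Rightarrow> complex \<Rightarrow> 'd \<Rightarrow> 'y \<times> 'x \<times> 'd"
  where "bb_D j A R B2 = dirichlet_op (bb_A j A R B2) (bb_R R)"

definition bb_B_at ::
    "('y::complex_banach \<Rightarrow> 'x::complex_banach) \<Rightarrow> ('y, 'x) partial_op
      \<Rightarrow> ('y \<Rightarrow> 'd::complex_banach) \<Rightarrow> ('y \<Rightarrow> 'd) \<Rightarrow> ('y \<Rightarrow> 'd) \<Rightarrow> ('d \<Rightarrow> 'd) \<Rightarrow> ('d \<Rightarrow> 'd)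
      \<Rightarrow> complex \<Rightarrow> 'd \<Rightarrow> 'd"
  where "bb_B_at j A R B1 B2 B3 B4 \<mu> = (\<lambda>y. B4 y + bb_B B1 B2 B3 B4 (bb_D j A R B2 \<mu> y))"

definition Gamma_set ::
    "('y::complex_banach \<Rightarrow> 'x::complex_banach) \<Rightarrow> ('y, 'x) partial_op
      \<Rightarrow> ('y \<Rightarrow> 'd::complex_banach) \<Rightarrow> ('y \<Rightarrow> 'd) \<Rightarrow> ('y \<Rightarrow> 'd) \<Rightarrow> ('d \<Rightarrow> 'd) \<Rightarrow> ('d \<Rightarrow> 'd)
      \<Rightarrow> complex set"
  where "Gamma_set j A R B1 B2 B3 B4 = {\<mu>. \<mu> \<in> resolvent_set (bb_A0 j A R B2) \<inter>
    resolvent_set (total_op (bb_B_at j A R B1 B2 B3 B4 \<mu>))}"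

end

theory Submission
  imports Defs
begin

text \<open>
Write \<open>T\<^sub>0\<close> for \<open>bb_A0\<close>, \<open>D\<^sub>\<mu>\<close> for \<open>bb_D\<close>, \<open>B\<close> for \<open>bb_B\<close> and \<open>B\<^sub>\<mu>\<close> for \<open>bb_B_at\<close>. The equation
\<open>(\<mu> - cal_A)(u, x) = (f, y)\<close> forces \<open>u = R(\<mu>, T\<^sub>0) f + D\<^sub>\<mu> x\<close>, because \<open>R(\<mu>, T\<^sub>0) f\<close> carries the
right-hand side with zero boundary value and \<open>D\<^sub>\<mu> x\<close> carries the boundary value with zero
right-hand side. Inserting this into the second row leaves \<open>(\<mu> - B\<^sub>\<mu>) x = y + B R(\<mu>, T\<^sub>0) f\<close>
(\<open>coupled_equation_iff\<close>). Solvability, eigenvectors and the block formula for the resolvent all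
follow from this one equivalence. Boundedness of \<open>D\<^sub>\<mu>\<close>, which makes the blocks bounded, comes
from the closed graph theorem and closedness of \<open>u \<mapsto> (A u, R u)\<close> (\<open>dirichlet_bounded\<close>).

That some \<open>\<mu>\<close> lies in both resolvent sets is the analytic part. The cosine function provides a group
on \<open>Y \<times> X\<close>, so large real \<open>l\<close> are in the resolvent set of the phase space operator, with a bound of
order \<open>1 / l\<close> (\<open>generator_resolvent_estimate\<close>). Comparing the Dirichlet operators at \<open>l\<close> and at a fixed
\<open>l0\<close>, this decay exactly compensates the growth of the spectral parameter, so the \<open>Y\<close>-component of
\<open>D\<^sub>l\<close> stays bounded (\<open>dirichlet_fst_bound\<close>). Hence \<open>B\<^sub>l\<close> is bounded uniformly in \<open>l\<close>, and
\<open>l - B\<^sub>l\<close> is invertible once \<open>l\<close> exceeds the bound.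
\<close>

section \<open>Closed graphs and uniform boundedness\<close>

text \<open>By Baire's theorem the closure of some sublevel set \<open>p x \<le> n\<close> has interior; since sublevel sets are
convex and symmetric, that closure contains a ball about \<open>0\<close>. So every small vector is the sum of
a series with \<open>p\<close> at most \<open>n / 2 ^ k\<close> on the \<open>k\<close>-th term, and countable subadditivity sums the
bounds. This lemma of Zabreiko has the closed graph theorem and the uniform boundedness principle as
instances.\<close>

lemma zabreiko:
  fixes p :: "'a::banach \<Rightarrow> real"
  assumes scale: "\<And>c x. p (c *\<^sub>R x) = \<bar>c\<bar> * p x"
    and add: "\<And>x y. p (x + y) \<le> p x + p y"
    and csub: "\<And>f. summable f \<Longrightarrow> summable (\<lambda>n. p (f n)) \<Longrightarrow> p (suminf f) \<le> (\<Sum>n. p (f n))"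
  obtains K where "0 \<le> K" "\<And>x. p x \<le> K * norm x"
proof -
  have p0: "p 0 = 0" using scale[of 0 0] by simp
  have pm: "p (- x) = p x" for x using scale[of "-1" x] by simp
  have nonneg: "0 \<le> p x" for x using add[of x "- x"] pm[of x] p0 by simp
  define A where "A n = {x. p x \<le> real n}" for n
  have "x \<in> (\<Union>n. closure (A n))" for x
  proof -
    obtain n where "p x \<le> real n" using real_arch_simple by blast
    then show ?thesis using closure_subset[of "A n"] by (auto simp: A_def)
  qed
  then have cover: "(\<Union>n. closure (A n)) = UNIV" by blast
  have "\<exists>n. interior (closure (A n)) \<noteq> {}"
  proof (rule ccontr)
    assume "\<not> ?thesis"
    then have "(euclidean :: 'a topology) interior_of \<Union>(range (\<lambda>n. closure (A n))) = {}"
      by (intro Baire_category_alt disjI1 completely_metrizable_space_euclidean) auto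
    then show False using cover by simp
  qed
  then obtain n where "interior (closure (A n)) \<noteq> {}" by blast
  then obtain x0 r where r: "r > 0" and ball: "ball x0 r \<subseteq> closure (A n)"
    by (metis all_not_in_conv mem_interior)
  \<comment> \<open>averaging approximations of \<open>x0 + z\<close> and \<open>x0 - z\<close> recentres the ball at \<open>0\<close>\<close>
  have approx: "\<exists>a. p a \<le> n \<and> norm (z - a) < e" if z: "norm z < r" and e: "e > 0" for z e
  proof -
    have "x0 + z \<in> closure (A n)" "x0 - z \<in> closure (A n)"
      using z ball by (auto simp: dist_norm)
    then obtain a b where a: "p a \<le> n" "norm (a - (x0 + z)) < e"
      and b: "p b \<le> n" "norm (b - (x0 - z)) < e"
      using e unfolding closure_approachable A_def dist_norm by blast
    have "p ((1/2) *\<^sub>R (a - b)) \<le> n"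
      using scale[of "1/2" "a - b"] add[of a "- b"] pm[of b] a b by simp
    moreover have "z - (1/2) *\<^sub>R (a - b) = (1/2) *\<^sub>R ((b - (x0 - z)) - (a - (x0 + z)))"
      by (simp add: algebra_simps flip: scaleR_add_left)
    then have "norm (z - (1/2) *\<^sub>R (a - b)) < e"
      using norm_triangle_ineq4[of "b - (x0 - z)" "a - (x0 + z)"] a b by simp
    ultimately show ?thesis by blast
  qed
  have step: "\<exists>a. p a \<le> n * (1/2)^k \<and> norm (z - a) < r * (1/2)^(Suc k)"
    if z: "norm z < r * (1/2)^k" for z k
  proof -
    have "norm ((2::real)^k *\<^sub>R z) < r" using z by (simp add: field_simps)
    then obtain a where a: "p a \<le> n" "norm (2^k *\<^sub>R z - a) < r / 2"
      using approx[of "2^k *\<^sub>R z" "r/2"] r by auto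
    have "z - (1/2)^k *\<^sub>R a = (1/2)^k *\<^sub>R (2^k *\<^sub>R z - a)"
      by (simp add: algebra_simps flip: power_mult_distrib)
    then have "norm (z - (1/2)^k *\<^sub>R a) = (1/2)^k * norm (2^k *\<^sub>R z - a)" by simp
    also have "\<dots> < (1/2)^k * (r/2)" using a by (intro mult_strict_left_mono) auto
    finally have "norm (z - (1/2)^k *\<^sub>R a) < r * (1/2)^(Suc k)" by (simp add: mult.commute)
    moreover have "p ((1/2)^k *\<^sub>R a) \<le> n * (1/2)^k"
      using a(1) by (subst scale) (simp add: field_simps)
    ultimately show ?thesis by blast
  qed
  define g where "g k z = (SOME a. p a \<le> n * (1/2)^k \<and> norm (z - a) < r * (1/2)^(Suc k))" for k z
  have g: "p (g k z) \<le> n * (1/2)^k \<and> norm (z - g k z) < r * (1/2)^(Suc k)"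
    if "norm z < r * (1/2)^k" for k z
    unfolding g_def by (rule someI_ex[OF step[OF that]])
  have unit: "p x \<le> 2 * n" if x: "norm x < r" for x
  proof -
    \<comment> \<open>the remainders after successive approximation steps\<close>
    define z where "z = rec_nat x (\<lambda>k z. z - g k z)"
    have z0: "z 0 = x" and zS: "z (Suc k) = z k - g k (z k)" for k by (simp_all add: z_def)
    have zb: "norm (z k) < r * (1/2)^k" for k
      by (induction k) (use x g in \<open>auto simp: z0 zS\<close>)
    have "(\<lambda>k. r * (1/2)^k) \<longlonglongrightarrow> r * 0"
      by (intro tendsto_intros LIMSEQ_realpow_zero) auto
    then have "(\<lambda>k. r * (1/2)^k) \<longlonglongrightarrow> 0" by simp
    moreover have "\<forall>\<^sub>F k in sequentially. norm (z k) \<le> r * (1/2)^k"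
      using zb less_imp_le by (intro always_eventually) blast
    ultimately have "z \<longlonglongrightarrow> 0" by (rule Lim_null_comparison[rotated])
    moreover have part: "(\<Sum>i<k. g i (z i)) = x - z k" for k
      by (induction k) (simp_all add: z0 zS)
    ultimately have sums: "(\<lambda>i. g i (z i)) sums x"
      unfolding sums_def part using tendsto_diff[OF tendsto_const[of x], of z 0] by simp
    have pb: "p (g k (z k)) \<le> n * (1/2)^k" for k using g zb by blast
    have geo: "(\<lambda>k. n * (1/2::real)^k) sums (n * 2)"
      using sums_mult[OF geometric_sums[of "1/2::real"], of n] by simp
    have sp: "summable (\<lambda>k. p (g k (z k)))"
      by (rule summable_comparison_test'[OF sums_summable[OF geo], of 0])
        (use pb nonneg in auto)
    have "p x \<le> (\<Sum>k. p (g k (z k)))"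
      using csub[OF sums_summable[OF sums] sp] sums_unique[OF sums] by simp
    also have "\<dots> \<le> n * 2"
      using suminf_le[OF pb sp sums_summable[OF geo]] sums_unique[OF geo] by simp
    finally show ?thesis by simp
  qed
  show thesis
  proof (rule that)
    show "0 \<le> 4 * n / r" using r by simp
    show "p x \<le> (4 * n / r) * norm x" for x
    proof (cases "x = 0")
      case False
      define c where "c = r / (2 * norm x)"
      have c: "c > 0" using False r by (simp add: c_def)
      have "norm (c *\<^sub>R x) < r" using False r by (simp add: c_def)
      then have "c * p x \<le> 2 * n" using unit[of "c *\<^sub>R x"] scale[of c x] c by simp
      then have "p x \<le> 2 * n / c" using c by (simp add: field_simps)
      then show ?thesis using False r by (simp add: c_def field_simps)
    qed (use p0 in simp)
  qed
qed

text \<open>Zabreiko's lemma applies to \<open>norm (T x)\<close>: closedness of the graph is what allows \<open>T\<close> to be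
applied termwise to a convergent series whose image is absolutely summable.\<close>

lemma closed_graph_theorem:
  fixes T :: "'a::banach \<Rightarrow> 'b::banach"
  assumes "linear T"
    and closed: "\<And>f x y. f \<longlonglongrightarrow> x \<Longrightarrow> (\<lambda>n. T (f n)) \<longlonglongrightarrow> y \<Longrightarrow> T x = y"
  shows "bounded_linear T"
proof -
  interpret linear T by fact
  obtain K where "\<And>x. norm (T x) \<le> K * norm x"
  proof (rule zabreiko[of "\<lambda>x. norm (T x)"])
    fix f :: "nat \<Rightarrow> 'a"
    assume f: "summable f" and Tf: "summable (\<lambda>n. norm (T (f n)))"
    have "(\<lambda>n. T (\<Sum>i<n. f i)) \<longlonglongrightarrow> (\<Sum>n. T (f n))"
      using summable_LIMSEQ[OF summable_norm_cancel[OF Tf]] by (simp add: sum)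
    then have "T (suminf f) = (\<Sum>n. T (f n))"
      using closed summable_LIMSEQ[OF f] by blast
    then show "norm (T (suminf f)) \<le> (\<Sum>n. norm (T (f n)))"
      using summable_norm[OF Tf] by simp
  qed (auto simp: add scale norm_triangle_ineq)
  then show ?thesis
    by (intro bounded_linear_intro[of T K]) (auto simp: add scale mult.commute)
qed

text \<open>Zabreiko's lemma applies to the pointwise supremum of \<open>norm (T i x)\<close>, which is countably
subadditive because each \<open>T i\<close> is continuous.\<close>

lemma uniform_boundedness:
  fixes T :: "'i \<Rightarrow> 'a::banach \<Rightarrow> 'b::real_normed_vector"
  assumes lin: "\<And>i. i \<in> I \<Longrightarrow> bounded_linear (T i)"
    and bdd: "\<And>x. \<exists>B. \<forall>i\<in>I. norm (T i x) \<le> B"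
  obtains K where "0 \<le> K" "\<And>i x. i \<in> I \<Longrightarrow> norm (T i x) \<le> K * norm x"
proof (cases "I = {}")
  case False
  define p where "p x = (SUP i\<in>I. norm (T i x))" for x
  have upper: "norm (T i x) \<le> p x" if "i \<in> I" for i x
    unfolding p_def using bdd[of x] that by (auto intro!: cSUP_upper bdd_aboveI)
  have least: "p x \<le> b" if "\<And>i. i \<in> I \<Longrightarrow> norm (T i x) \<le> b" for x b
    unfolding p_def using False that by (rule cSUP_least)
  have le: "p (c *\<^sub>R x) \<le> \<bar>c\<bar> * p x" for c x
    using upper[of _ x]
    by (intro least)
      (auto simp: linear_scale[OF bounded_linear.linear[OF lin]] intro!: mult_left_mono)
  have scale: "p (c *\<^sub>R x) = \<bar>c\<bar> * p x" for c x
  proof (cases "c = 0")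
    case True
    then show ?thesis using le[of 0 x] False upper[of _ 0] norm_ge_zero
      by (metis abs_zero antisym ex_in_conv mult_zero_left order_trans scaleR_zero_left)
  next
    case False
    then have "\<bar>c\<bar> * p x \<le> p (c *\<^sub>R x)"
      using le[of "1/c" "c *\<^sub>R x"] by (simp add: field_simps)
    with le show ?thesis by (simp add: antisym)
  qed
  obtain K where K: "0 \<le> K" "\<And>x. p x \<le> K * norm x"
  proof (rule zabreiko[of p])
    fix f :: "nat \<Rightarrow> 'a"
    assume f: "summable f" and pf: "summable (\<lambda>n. p (f n))"
    show "p (suminf f) \<le> (\<Sum>n. p (f n))"
    proof (rule least)
      fix i assume i: "i \<in> I"
      have n: "summable (\<lambda>n. norm (T i (f n)))"
        by (rule summable_comparison_test'[OF pf, of 0]) (use upper[OF i] in auto)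
      have "(\<lambda>n. norm (T i (\<Sum>k<n. f k))) \<longlonglongrightarrow> norm (T i (suminf f))"
        by (intro tendsto_norm bounded_linear.tendsto[OF lin[OF i]] summable_LIMSEQ f)
      moreover have "norm (T i (\<Sum>k<n. f k)) \<le> (\<Sum>n. p (f n))" for n
      proof -
        have "norm (T i (\<Sum>k<n. f k)) \<le> (\<Sum>k<n. norm (T i (f k)))"
          by (simp add: linear_sum[OF bounded_linear.linear[OF lin[OF i]]] norm_sum)
        also have "\<dots> \<le> (\<Sum>k<n. p (f k))" by (intro sum_mono upper i)
        also have "\<dots> \<le> (\<Sum>n. p (f n))"
          using order_trans[OF norm_ge_zero upper[OF i]] by (intro sum_le_suminf pf) auto
        finally show ?thesis .
      qed
      ultimately show "norm (T i (suminf f)) \<le> (\<Sum>n. p (f n))"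
        by (intro LIMSEQ_le_const2) auto
    qed
  next
    fix x y
    show "p (x + y) \<le> p x + p y"
      using upper[of _ x] upper[of _ y]
      by (intro least) (smt (verit) bounded_linear.axioms(1) lin linear_add norm_triangle_ineq)
  qed (auto simp: scale)
  show thesis by (rule that[OF K(1)]) (metis upper K(2) order_trans)
next
  case True
  then show thesis using that[of 0] by auto
qed

section \<open>Resolvent estimates for generators of groups\<close>

lemma unique_solution_of_contraction:
  fixes S :: "'a::banach \<Rightarrow> 'a"
  assumes "bounded_linear S" and q: "0 \<le> q" "q < 1" and S: "\<And>x. norm (S x) \<le> q * norm x"
  shows "\<exists>!x. x - S x = y"
proof -
  interpret bounded_linear S by fact
  have "\<exists>!x. y + S x = x"
    by (rule banach_fix_type[OF q]) (use S in \<open>auto simp: dist_norm simp flip: diff\<close>)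
  moreover have "y + S x = x \<longleftrightarrow> x - S x = y" for x by (auto simp: algebra_simps)
  ultimately show ?thesis by simp
qed

text \<open>Generators are described by difference quotients; calculus on orbits needs derivatives.\<close>

lemma has_vector_derivative_at_iff_difference_quotient:
  "(f has_vector_derivative D) (at t) \<longleftrightarrow> ((\<lambda>h. (f (t + h) - f t) /\<^sub>R h) \<longlongrightarrow> D) (at 0)"
proof -
  have "(f has_vector_derivative D) (at t) \<longleftrightarrow>
      ((\<lambda>h. norm (f (t + h) - f t - h *\<^sub>R D) / norm h) \<longlongrightarrow> 0) (at 0)"
    by (simp add: has_vector_derivative_def has_derivative_at bounded_linear_scaleR_left)
  also have "\<dots> \<longleftrightarrow> ((\<lambda>h. norm ((f (t + h) - f t) /\<^sub>R h - D)) \<longlongrightarrow> 0) (at 0)"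
  proof (rule filterlim_cong)
    have "norm (f (t + h) - f t - h *\<^sub>R D) / norm h = norm ((f (t + h) - f t) /\<^sub>R h - D)"
      if "h \<noteq> 0" for h
    proof -
      have "(f (t + h) - f t) /\<^sub>R h - D = (f (t + h) - f t - h *\<^sub>R D) /\<^sub>R h"
        using that by (simp add: algebra_simps)
      then show ?thesis by (simp add: divide_inverse)
    qed
    then show "\<forall>\<^sub>F h in at 0. norm (f (t + h) - f t - h *\<^sub>R D) / norm h =
        norm ((f (t + h) - f t) /\<^sub>R h - D)"
      by (auto simp: eventually_at_filter)
  qed auto
  finally show ?thesis unfolding tendsto_norm_zero_iff LIM_zero_iff .
qed

lemma C0_group_bounded_on_unit_interval:
  assumes "C0_group U"
  obtains M where "1 \<le> M" "\<And>t x. t \<in> {0..1} \<Longrightarrow> norm (U t x) \<le> M * norm x"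
proof -
  obtain K where "0 \<le> K" "\<And>t x. t \<in> {0..1} \<Longrightarrow> norm (U t x) \<le> K * norm x"
  proof (rule uniform_boundedness[of "{0..1}" U])
    show "bounded_linear (U t)" for t
      using assms by (simp add: C0_group_def bounded_clinear_def)
    fix x
    have "continuous_on {0..1} (\<lambda>t. U t x)"
      using assms continuous_on_subset unfolding C0_group_def by blast
    then have "bounded ((\<lambda>t. U t x) ` {0..1})"
      by (intro compact_imp_bounded compact_continuous_image) auto
    then show "\<exists>B. \<forall>t\<in>{0..1}. norm (U t x) \<le> B" unfolding bounded_iff by auto
  qed auto
  moreover have "K * norm x \<le> max 1 K * norm x" for x :: 'a by (simp add: mult_right_mono)
  ultimately show thesis by (intro that[of "max 1 K"]) (auto intro: order_trans)
qed

text \<open>For a group with \<open>norm (U t x) \<le> M * norm x\<close> on \<open>[0,1]\<close>, the resolvent at a large real \<open>l\<close> is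
obtained without improper integrals: with \<open>J g = (\<integral>t=0..1. exp (- l t) U t g)\<close> one has
\<open>(l - T) (J g) = g - exp (- l) U 1 g\<close>, and the right-hand side is a small perturbation of \<open>g\<close>
as soon as \<open>l \<ge> 2 M\<close>, because then \<open>M * exp (- l) \<le> 1/2\<close>.\<close>

locale C0_group_generator =
  fixes T :: "('a::complex_banach, 'a) partial_op" and U :: "real \<Rightarrow> 'a \<Rightarrow> 'a"
  assumes group: "C0_group U"
    and dom_eq: "op_dom T = {x. \<exists>y. ((\<lambda>h. (U h x - x) /\<^sub>R h) \<longlongrightarrow> y) (at 0)}"
    and deriv0: "x \<in> op_dom T \<Longrightarrow> ((\<lambda>h. (U h x - x) /\<^sub>R h) \<longlongrightarrow> op_fun T x) (at 0)"
begin

lemma U_linear: "bounded_linear (U t)"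
  using group by (simp add: C0_group_def bounded_clinear_def)

lemma U_0: "U 0 x = x" and U_add: "U (s + t) x = U s (U t x)"
  using group by (simp_all add: C0_group_def)

lemma U_cont: "continuous_on S (\<lambda>t. U t x)"
  using group continuous_on_subset unfolding C0_group_def by blast

lemma orbit_derivative:
  assumes "x \<in> op_dom T"
  shows "((\<lambda>t. U t x) has_vector_derivative U t (op_fun T x)) (at t)"
proof -
  interpret bounded_linear "U t" by (rule U_linear)
  show ?thesis
    unfolding has_vector_derivative_at_iff_difference_quotient U_add
    using tendsto[OF deriv0[OF assms]] by (simp add: scaleR diff)
qed

text \<open>With \<open>f = (l - T) x\<close>, the curve \<open>exp (- l t) U t x\<close> has derivative \<open>- exp (- l t) U t f\<close>, so
between \<open>t = 0\<close> and \<open>t = 1\<close> it moves by at most \<open>M * norm f / l\<close>. Since its endpoint has at most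
half the norm of \<open>x\<close>, the other half is controlled by \<open>f\<close>.\<close>

lemma a_priori_estimate:
  assumes M: "1 \<le> M" "\<And>t x. t \<in> {0..1} \<Longrightarrow> norm (U t x) \<le> M * norm x"
    and l: "2 * M \<le> l" and x: "x \<in> op_dom T"
  shows "norm x \<le> 2 * M / l * norm (l *\<^sub>R x - op_fun T x)"
proof -
  have l0: "l > 0" using M l by simp
  have small: "exp (- l) * M \<le> 1/2"
    using order_trans[OF l, of "exp l"] exp_ge_add_one_self[of l] by (simp add: exp_minus field_simps)
  define f where "f = l *\<^sub>R x - op_fun T x"
  define g where "g t = exp (- l * t) *\<^sub>R U t x" for t
  define \<phi> where "\<phi> t = - (M * norm f / l) * exp (- l * t)" for t
  have g': "(g has_vector_derivative - exp (- l * t) *\<^sub>R U t f) (at t)" for t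
  proof -
    have "((\<lambda>t. exp (- l * t)) has_real_derivative exp (- l * t) * (- l)) (at t)"
      by (auto intro!: derivative_eq_intros)
    from has_vector_derivative_scaleR[OF this orbit_derivative[OF x, of t]] show ?thesis
      unfolding g_def f_def
      by (simp add: linear_simps[OF U_linear] algebra_simps)
  qed
  have \<phi>': "(\<phi> has_vector_derivative M * norm f * exp (- l * t)) (at t)" for t
    unfolding \<phi>_def has_real_derivative_iff_has_vector_derivative[symmetric]
    using l0 by (auto intro!: derivative_eq_intros)
  have "norm (g 1 - g 0) \<le> \<phi> 1 - \<phi> 0"
  proof (rule differentiable_bound_general[OF zero_less_one])
    show "continuous_on {0..1} g" "continuous_on {0..1} \<phi>"
      using has_vector_derivative_continuous[OF g'] has_vector_derivative_continuous[OF \<phi>']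
      by (simp_all add: continuous_at_imp_continuous_on)
    show "norm (- exp (- l * t) *\<^sub>R U t f) \<le> M * norm f * exp (- l * t)" if "0 < t" "t < 1" for t
      using M(2)[of t f] that by (simp add: mult.commute)
  qed (use g' \<phi>' in blast)+
  also have "\<dots> \<le> M * norm f / l"
    using M l0 by (simp add: \<phi>_def field_simps)
  finally have "norm (x - g 1) \<le> M * norm f / l"
    by (simp add: g_def U_0 norm_minus_commute)
  moreover have "norm (g 1) \<le> norm x / 2"
  proof -
    have "norm (g 1) \<le> exp (- l) * (M * norm x)"
      using M(2)[of 1 x] by (simp add: g_def)
    also have "\<dots> \<le> 1/2 * norm x"
      using mult_right_mono[OF small norm_ge_zero[of x]] by (simp add: mult.assoc)
    finally show ?thesis by simp
  qed
  ultimately have "norm x \<le> M * norm f / l + norm x / 2"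
    using norm_triangle_ineq[of "x - g 1" "g 1"] by simp
  then show ?thesis by (simp add: f_def)
qed

text \<open>The solution is \<open>J g\<close>, where \<open>g\<close> solves \<open>g - exp (- l) U 1 g = f\<close>. The integral is represented by
an antiderivative \<open>\<Phi>\<close> of the integrand \<open>\<phi>\<close>. The functional equation of the group turns \<open>U h\<close>
applied to the integral into a shifted integral, whose derivative at \<open>h = 0\<close> is given by the
boundary values of \<open>\<phi>\<close>.\<close>

lemma resolvent_equation_solvable:
  assumes M: "1 \<le> M" "\<And>t x. t \<in> {0..1} \<Longrightarrow> norm (U t x) \<le> M * norm x"
    and l: "2 * M \<le> l"
  shows "\<exists>x\<in>op_dom T. l *\<^sub>R x - op_fun T x = f"
proof -
  have small: "exp (- l) * M \<le> 1/2"
    using order_trans[OF l, of "exp l"] exp_ge_add_one_self[of l] by (simp add: exp_minus field_simps)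
  have "\<exists>!g. g - exp (- l) *\<^sub>R U 1 g = f"
  proof (rule unique_solution_of_contraction[of _ "1/2"])
    show "bounded_linear (\<lambda>g. exp (- l) *\<^sub>R U 1 g)"
      by (intro bounded_linear_compose[OF bounded_linear_scaleR_right] U_linear)
    fix g
    have "norm (exp (- l) *\<^sub>R U 1 g) \<le> exp (- l) * (M * norm g)"
      using M(2)[of 1 g] by simp
    also have "\<dots> \<le> 1/2 * norm g"
      using mult_right_mono[OF small norm_ge_zero[of g]] by (simp add: mult.assoc)
    finally show "norm (exp (- l) *\<^sub>R U 1 g) \<le> 1/2 * norm g" .
  qed auto
  then obtain g where g: "g - exp (- l) *\<^sub>R U 1 g = f" by blast
  define \<phi> where "\<phi> t = exp (- l * t) *\<^sub>R U t g" for t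
  have "continuous_on {-1..2} \<phi>"
    unfolding \<phi>_def by (intro continuous_intros U_cont)
  \<comment> \<open>the margin around \<open>[0,1]\<close> leaves room for small shifts in both directions\<close>
  then obtain \<Phi> where \<Phi>w: "\<And>t. t \<in> {-1..2} \<Longrightarrow> (\<Phi> has_vector_derivative \<phi> t) (at t within {-1..2})"
    using antiderivative_continuous by blast
  have \<Phi>: "(\<Phi> has_vector_derivative \<phi> t) (at t)" if "-1 < t" "t < 2" for t
    using \<Phi>w[of t] at_within_interior[of t "{-1..2}"] that by (simp add: interior_atLeastAtMost_real)
  define x where "x = \<Phi> 1 - \<Phi> 0"
  define F where "F h = exp (l * h) *\<^sub>R (\<Phi> (1 + h) - \<Phi> h)" for h
  \<comment> \<open>both sides are increments over \<open>[0,1]\<close> of functions with equal derivatives\<close>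
  have U_x: "U h x = F h" if h: "-1 < h" "h < 1" for h
  proof -
    have "((\<lambda>s. U h (\<Phi> s) - exp (l * h) *\<^sub>R \<Phi> (s + h)) has_vector_derivative 0) (at s within {0..1})"
      if s: "s \<in> {0..1}" for s
    proof -
      have 1: "((\<lambda>s. U h (\<Phi> s)) has_vector_derivative U h (\<phi> s)) (at s)"
        using s by (intro bounded_linear.has_vector_derivative[OF U_linear] \<Phi>) auto
      have "((\<lambda>s. \<Phi> (s + h)) has_vector_derivative \<phi> (s + h)) (at s)"
        using \<Phi>[of "s + h"] s h
        unfolding has_vector_derivative_at_iff_difference_quotient by (simp add: add_ac)
      then have 2: "((\<lambda>s. exp (l * h) *\<^sub>R \<Phi> (s + h)) has_vector_derivative exp (l * h) *\<^sub>R \<phi> (s + h)) (at s)"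
        by (rule bounded_linear.has_vector_derivative[OF bounded_linear_scaleR_right])
      have "U h (\<phi> s) = exp (l * h) *\<^sub>R \<phi> (s + h)"
        using U_add[of h s g]
        by (simp add: \<phi>_def linear_simps[OF U_linear] algebra_simps flip: exp_add)
      then show ?thesis
        using has_vector_derivative_diff[OF 1 2] by (simp add: has_vector_derivative_at_within)
    qed
    from has_vector_derivative_zero_constant[OF convex_closed_interval this]
    obtain c where c: "\<And>s. s \<in> {0..1} \<Longrightarrow> U h (\<Phi> s) - exp (l * h) *\<^sub>R \<Phi> (s + h) = c"
      by blast
    from c[of 0] c[of 1] show ?thesis
      by (simp add: x_def F_def linear_simps[OF U_linear] algebra_simps)
  qed
  have "(F has_vector_derivative l *\<^sub>R x + (\<phi> 1 - \<phi> 0)) (at 0)"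
  proof -
    have 1: "((\<lambda>h. \<Phi> (1 + h)) has_vector_derivative \<phi> 1) (at 0)"
      using \<Phi>[of 1] unfolding has_vector_derivative_at_iff_difference_quotient by simp
    have 2: "((\<lambda>h. exp (l * h)) has_real_derivative l) (at 0)"
      by (auto intro!: derivative_eq_intros)
    show ?thesis
      using has_vector_derivative_scaleR[OF 2 has_vector_derivative_diff[OF 1 \<Phi>[of 0]]]
      by (simp add: F_def[abs_def] x_def algebra_simps)
  qed
  then have "((\<lambda>h. (F h - x) /\<^sub>R h) \<longlongrightarrow> l *\<^sub>R x + (\<phi> 1 - \<phi> 0)) (at 0)"
    unfolding has_vector_derivative_at_iff_difference_quotient by (simp add: F_def x_def)
  moreover have "\<forall>\<^sub>F h in at 0. (F h - x) /\<^sub>R h = (U h x - x) /\<^sub>R h"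
  proof -
    have "\<forall>\<^sub>F h in at 0. h \<in> {-1<..<1::real}" by (rule eventually_at_in_open') auto
    then show ?thesis by (rule eventually_mono) (auto simp: U_x)
  qed
  ultimately have lim: "((\<lambda>h. (U h x - x) /\<^sub>R h) \<longlongrightarrow> l *\<^sub>R x + (\<phi> 1 - \<phi> 0)) (at 0)"
    by (rule Lim_transform_eventually)
  then have x: "x \<in> op_dom T" unfolding dom_eq by blast
  have "op_fun T x = l *\<^sub>R x + (\<phi> 1 - \<phi> 0)"
    using tendsto_unique[OF _ deriv0[OF x] lim] by simp
  then have "l *\<^sub>R x - op_fun T x = f"
    using g by (simp add: \<phi>_def U_0)
  with x show ?thesis by blast
qed

end

text \<open>The decay \<open>M / l\<close> of the resolvent is what later keeps the boundary feedback bounded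
as \<open>l\<close> grows.\<close>

lemma generator_resolvent_estimate:
  assumes "generates_C0_group T"
  obtains M l0 where "0 < M" "0 < l0"
    and "\<And>l f. l0 \<le> l \<Longrightarrow> \<exists>x\<in>op_dom T. l *\<^sub>R x - op_fun T x = f"
    and "\<And>l x. l0 \<le> l \<Longrightarrow> x \<in> op_dom T \<Longrightarrow> norm x \<le> M / l * norm (l *\<^sub>R x - op_fun T x)"
proof -
  obtain U where "C0_group_generator T U"
    using assms unfolding generates_C0_group_def C0_group_generator_def by blast
  then interpret C0_group_generator T U .
  obtain M where "1 \<le> M" "\<And>t x. t \<in> {0..1} \<Longrightarrow> norm (U t x) \<le> M * norm x"
    using C0_group_bounded_on_unit_interval[OF group] by blast
  from a_priori_estimate[OF this] resolvent_equation_solvable[OF this] \<open>1 \<le> M\<close>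
  show thesis by (intro that[of "2 * M" "2 * M"]) auto
qed

section \<open>Complex linear operators and resolvents\<close>

lemma bounded_clinearI:
  assumes "\<And>x y. f (x + y) = f x + f y" "\<And>c x. f (c *\<^sub>C x) = c *\<^sub>C f x"
    and "\<And>x. norm (f x) \<le> K * norm x"
  shows "bounded_clinear f"
proof -
  have "f (r *\<^sub>R x) = r *\<^sub>R f x" for r x
    using assms(2)[of "complex_of_real r" x] by (simp add: scaleC_of_real)
  then show ?thesis
    unfolding bounded_clinear_def using assms
    by (auto intro!: bounded_linear_intro[of f K] simp: mult.commute)
qed

lemma bounded_clinear_imp_bounded_linear: "bounded_clinear f \<Longrightarrow> bounded_linear f"
  by (simp add: bounded_clinear_def)

lemma scaleC_zero_right [simp]: "c *\<^sub>C (0::'a::complex_normed_vector) = 0"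
  using scaleC_add_right[of c 0 "0::'a"] by simp

lemma scaleC_minus_right [simp]: "c *\<^sub>C (- x) = - (c *\<^sub>C (x::'a::complex_normed_vector))"
  using minus_unique[of "c *\<^sub>C x" "c *\<^sub>C (- x)"] scaleC_add_right[of c x "- x"] by simp

lemma scaleC_diff_right: "c *\<^sub>C (x - y) = c *\<^sub>C x - c *\<^sub>C (y::'a::complex_normed_vector)"
  using scaleC_add_right[of c x "- y"] by simp

lemma scaleC_left_commute: "a *\<^sub>C b *\<^sub>C x = b *\<^sub>C a *\<^sub>C (x::'a::complex_normed_vector)"
  by (simp add: scaleC_scaleC mult.commute)

lemma scaleC_minus_one: "(- 1) *\<^sub>C x = - (x::'a::complex_normed_vector)"
  using scaleC_of_real[of "- 1" x] by simp

lemma tendsto_scaleC: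
  fixes f :: "'b \<Rightarrow> 'a::complex_normed_vector"
  assumes "(f \<longlongrightarrow> x) F"
  shows "((\<lambda>n. c *\<^sub>C f n) \<longlongrightarrow> c *\<^sub>C x) F"
proof -
  have "bounded_linear (\<lambda>x::'a. c *\<^sub>C x)"
    by (rule bounded_linear_intro[of _ "cmod c"])
      (simp_all add: scaleC_add_right norm_scaleC mult.commute scaleC_left_commute flip: scaleC_of_real)
  then show ?thesis using assms by (rule bounded_linear.tendsto)
qed

lemma
  assumes "bounded_clinear f"
  shows bounded_clinear_add: "f (x + y) = f x + f y"
    and bounded_clinear_zero: "f 0 = 0"
    and bounded_clinear_scaleC: "f (c *\<^sub>C x) = c *\<^sub>C f x"
  using assms linear_simps[of f] by (auto simp: bounded_clinear_def)

lemma
  assumes "clinear_on S f" "x \<in> S"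
  shows clinear_on_add: "y \<in> S \<Longrightarrow> x + y \<in> S \<and> f (x + y) = f x + f y"
    and clinear_on_scaleC: "c *\<^sub>C x \<in> S \<and> f (c *\<^sub>C x) = c *\<^sub>C f x"
    and clinear_on_diff: "y \<in> S \<Longrightarrow> x - y \<in> S \<and> f (x - y) = f x - f y"
proof -
  show add: "x + y \<in> S \<and> f (x + y) = f x + f y" if "y \<in> S" for y
    using assms that by (simp add: clinear_on_def csubspace_def)
  have scale: "c *\<^sub>C x \<in> S \<and> f (c *\<^sub>C x) = c *\<^sub>C f x" if "x \<in> S" for c x
    using assms that by (simp add: clinear_on_def csubspace_def)
  show "c *\<^sub>C x \<in> S \<and> f (c *\<^sub>C x) = c *\<^sub>C f x" using scale assms by blast
  show "x - y \<in> S \<and> f (x - y) = f x - f y" if "y \<in> S" for y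
    using scale[OF that, of "- 1"] add[of "(- 1) *\<^sub>C y"] by (simp add: scaleC_minus_one)
qed

lemma clinear_on_zero: "clinear_on S f \<Longrightarrow> 0 \<in> S \<and> f 0 = 0"
  using clinear_on_diff[of S f 0 0] by (auto simp: clinear_on_def csubspace_def)

lemma bounded_clinear_compose: "bounded_clinear f \<Longrightarrow> bounded_clinear g \<Longrightarrow> bounded_clinear (\<lambda>x. f (g x))"
  by (auto simp: bounded_clinear_def intro: bounded_linear_compose)

lemma bounded_clinear_plus: "bounded_clinear f \<Longrightarrow> bounded_clinear g \<Longrightarrow> bounded_clinear (\<lambda>x. f x + g x)"
  by (auto simp: bounded_clinear_def scaleC_add_right intro: bounded_linear_add)

lemma bounded_clinear_Pair: "bounded_clinear f \<Longrightarrow> bounded_clinear g \<Longrightarrow> bounded_clinear (\<lambda>x. (f x, g x))"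
  by (auto simp: bounded_clinear_def scaleC_prod_def intro: bounded_linear_Pair)

lemma bounded_clinear_fst: "bounded_clinear fst"
  and bounded_clinear_snd: "bounded_clinear snd"
  by (auto simp: bounded_clinear_def scaleC_prod_def bounded_linear_fst bounded_linear_snd)

lemma bounded_clinear_Pair_zero: "bounded_clinear (\<lambda>y. (0, y))"
  by (rule bounded_clinearI[of _ 1]) (auto simp: scaleC_prod_def norm_Pair)

lemma bounded_clinear_bound:
  assumes "bounded_clinear f"
  obtains K where "0 \<le> K" "\<And>x. norm (f x) \<le> K * norm x"
  using bounded_linear.nonneg_bounded[of f] assms by (auto simp: bounded_clinear_def mult.commute)

lemma bounded_clinear_closed_graph:
  fixes f :: "'a::complex_banach \<Rightarrow> 'b::complex_banach"
  assumes add: "\<And>x y. f (x + y) = f x + f y" and scale: "\<And>c x. f (c *\<^sub>C x) = c *\<^sub>C f x"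
    and closed: "\<And>X x y. X \<longlonglongrightarrow> x \<Longrightarrow> (\<lambda>n. f (X n)) \<longlonglongrightarrow> y \<Longrightarrow> f x = y"
  shows "bounded_clinear f"
proof -
  have "f (r *\<^sub>R x) = r *\<^sub>R f x" for r x
    using scale[of "complex_of_real r" x] by (simp add: scaleC_of_real)
  then have "linear f" using add by (intro linearI)
  then show ?thesis
    using closed_graph_theorem closed scale unfolding bounded_clinear_def by blast
qed

text \<open>This equivalence is the form in which resolvents are used throughout: it combines membership in
the domain, existence and uniqueness, so that solving a coupled system becomes rewriting.\<close>

lemma resolvent_equation_iff:
  assumes "\<mu> \<in> resolvent_set T"
  shows "x \<in> op_dom T \<and> \<mu> *\<^sub>C x - op_fun T x = y \<longleftrightarrow> x = resolvent T \<mu> y"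
proof -
  have bij: "bij_betw (\<lambda>x. \<mu> *\<^sub>C x - op_fun T x) (op_dom T) UNIV"
    using assms by (simp add: resolvent_set_def)
  show ?thesis
    unfolding resolvent_def
    using the_inv_into_f_f[OF bij_betw_imp_inj_on[OF bij]]
      f_the_inv_into_f_bij_betw[OF bij] the_inv_into_into[OF bij_betw_imp_inj_on[OF bij] _ subset_refl, of y]
      bij by (auto simp: bij_betw_def)
qed

lemma resolvent_bounded: "\<mu> \<in> resolvent_set T \<Longrightarrow> bounded_clinear (resolvent T \<mu>)"
  by (simp add: resolvent_set_def)

lemma resolvent_eqI:
  assumes "bounded_clinear G"
    and G: "\<And>x y. x \<in> op_dom T \<and> \<mu> *\<^sub>C x - op_fun T x = y \<longleftrightarrow> x = G y"
  shows "\<mu> \<in> resolvent_set T" "resolvent T \<mu> = G"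
proof -
  have bij: "bij_betw (\<lambda>x. \<mu> *\<^sub>C x - op_fun T x) (op_dom T) UNIV"
  proof (rule bij_betw_byWitness[where f' = G])
    show "\<forall>x\<in>op_dom T. G (\<mu> *\<^sub>C x - op_fun T x) = x" using G by metis
    show "\<forall>y\<in>UNIV. \<mu> *\<^sub>C G y - op_fun T (G y) = y" "range G \<subseteq> op_dom T" using G by blast+
  qed simp
  have "the_inv_into (op_dom T) (\<lambda>x. \<mu> *\<^sub>C x - op_fun T x) y = G y" for y
    using G bij_betw_imp_inj_on[OF bij] by (intro the_inv_into_f_eq) auto
  then show "resolvent T \<mu> = G" by (auto simp: resolvent_def)
  with bij assms(1) show "\<mu> \<in> resolvent_set T" by (simp add: resolvent_set_def)
qed

text \<open>Solvability together with an a priori estimate suffices: the estimate gives uniqueness as well as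
boundedness of the inverse.\<close>

lemma resolvent_setI:
  fixes T :: "('a::complex_banach, 'a) partial_op"
  assumes lin: "clinear_on (op_dom T) (op_fun T)"
    and ex: "\<And>y. \<exists>x\<in>op_dom T. \<mu> *\<^sub>C x - op_fun T x = y"
    and bound: "\<And>x. x \<in> op_dom T \<Longrightarrow> norm x \<le> K * norm (\<mu> *\<^sub>C x - op_fun T x)"
  shows "\<mu> \<in> resolvent_set T"
proof -
  define E where "E x = \<mu> *\<^sub>C x - op_fun T x" for x
  have add: "x + y \<in> op_dom T \<and> E (x + y) = E x + E y"
    and diff: "x - y \<in> op_dom T \<and> E (x - y) = E x - E y"
    and scale: "c *\<^sub>C x \<in> op_dom T \<and> E (c *\<^sub>C x) = c *\<^sub>C E x"
    if "x \<in> op_dom T" "y \<in> op_dom T" for x y c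
    using clinear_on_add[OF lin that] clinear_on_diff[OF lin that] clinear_on_scaleC[OF lin that(1)]
    by (auto simp: E_def scaleC_add_right scaleC_diff_right scaleC_left_commute[of \<mu> c])
  have inj: "x = y" if "x \<in> op_dom T" "y \<in> op_dom T" "E x = E y" for x y
    using bound[of "x - y"] diff[OF that(1,2)] that(3) by (simp add: E_def)
  obtain G where G: "\<And>y. G y \<in> op_dom T \<and> E (G y) = y"
    using ex unfolding E_def by metis
  have "bounded_clinear G"
  proof (rule bounded_clinearI)
    show "G (x + y) = G x + G y" for x y using inj G add by metis
    show "G (c *\<^sub>C x) = c *\<^sub>C G x" for c x using inj G scale by metis
    show "norm (G y) \<le> K * norm y" for y using bound[of "G y"] G by (simp add: E_def)
  qed
  moreover have "x \<in> op_dom T \<and> \<mu> *\<^sub>C x - op_fun T x = y \<longleftrightarrow> x = G y" for x y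
    using inj G unfolding E_def by metis
  ultimately show ?thesis by (rule resolvent_eqI(1))
qed

text \<open>The Neumann criterion, with the series replaced by the fixed point of a contraction.\<close>

lemma in_resolvent_set_if_norm_less:
  fixes f :: "'a::complex_banach \<Rightarrow> 'a"
  assumes f: "bounded_clinear f" and C: "0 \<le> C" "\<And>x. norm (f x) \<le> C * norm x" "C < l"
  shows "complex_of_real l \<in> resolvent_set (total_op f)"
proof (rule resolvent_setI)
  show "clinear_on (op_dom (total_op f)) (op_fun (total_op f))"
    using f by (simp add: clinear_on_def csubspace_def bounded_clinear_add bounded_clinear_scaleC)
  have l: "l > 0" using C by simp
  show "\<exists>x\<in>op_dom (total_op f). complex_of_real l *\<^sub>C x - op_fun (total_op f) x = y" for y
  proof -
    have "\<exists>!x. x - (1/l) *\<^sub>R f x = (1/l) *\<^sub>R y"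
    proof (rule unique_solution_of_contraction[of _ "C / l"])
      show "bounded_linear (\<lambda>x. (1/l) *\<^sub>R f x)"
        using f by (intro bounded_linear_compose[OF bounded_linear_scaleR_right])
          (simp add: bounded_clinear_def)
    qed (use C l in \<open>auto simp: field_simps\<close>)
    then obtain x where "x - (1/l) *\<^sub>R f x = (1/l) *\<^sub>R y" by blast
    then have "l *\<^sub>R (x - (1/l) *\<^sub>R f x) = l *\<^sub>R (1/l) *\<^sub>R y" by simp
    then have "l *\<^sub>R x - f x = y" using l by (simp add: scaleR_diff_right)
    then show ?thesis by (auto simp: scaleC_of_real)
  qed
  show "norm x \<le> 1 / (l - C) * norm (complex_of_real l *\<^sub>C x - op_fun (total_op f) x)" for x
  proof -
    have "l * norm x - C * norm x \<le> norm (l *\<^sub>R x - f x)"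
      using norm_triangle_ineq2[of "l *\<^sub>R x" "f x"] C(2)[of x] l by simp
    then show ?thesis using C(3) by (simp add: scaleC_of_real field_simps)
  qed
qed

section \<open>Operators coupled through a boundary value\<close>

text \<open>The abstract form of the problem: a maximal operator \<open>T\<close> with boundary operator \<open>S\<close>, coupled to a
dynamics \<open>B u + C x\<close> for the boundary value \<open>x = S u\<close>. The spectral equivalences and the resolvent
formula hold at this level of generality.\<close>

locale boundary_coupling =
  fixes T :: "('a::complex_banach, 'a) partial_op" and S :: "'a \<Rightarrow> 'd::complex_banach"
    and B :: "'a \<Rightarrow> 'd" and C :: "'d \<Rightarrow> 'd"
  assumes T_lin: "clinear_on (op_dom T) (op_fun T)"
    and S_lin: "clinear_on (op_dom T) S"
    and S_surj: "S ` op_dom T = UNIV"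
    and closed: "closed_op (Op (op_dom T) (\<lambda>u. (op_fun T u, S u)))"
    and B: "bounded_clinear B" and C: "bounded_clinear C"
begin

abbreviation "T0 \<equiv> restrict_ker T S"
abbreviation "coupled_op \<equiv> Op {(u, x). u \<in> op_dom T \<and> S u = x} (block_op (op_fun T) (\<lambda>_. 0) B C)"
abbreviation "D \<equiv> dirichlet_op T S"
abbreviation "feedback \<mu> \<equiv> \<lambda>y. C y + B (D \<mu> y)"

lemma resolvent_T0_iff:
  assumes "\<mu> \<in> resolvent_set T0"
  shows "u \<in> op_dom T \<and> S u = 0 \<and> \<mu> *\<^sub>C u - op_fun T u = f \<longleftrightarrow> u = resolvent T0 \<mu> f"
  using resolvent_equation_iff[OF assms, of u f] by (auto simp: restrict_ker_def)

text \<open>A preimage of \<open>y\<close> under \<open>S\<close> is corrected to an element of \<open>ker (\<mu> - T)\<close> by subtracting the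
resolvent of \<open>T0\<close> applied to its defect; the correction lies in \<open>ker S\<close> and leaves \<open>y\<close> unchanged.\<close>

lemma dirichlet_iff:
  assumes \<mu>: "\<mu> \<in> resolvent_set T0"
  shows "u \<in> op_dom T \<and> \<mu> *\<^sub>C u - op_fun T u = 0 \<and> S u = y \<longleftrightarrow> u = D \<mu> y"
proof -
  define N where "N = {u \<in> op_dom T. \<mu> *\<^sub>C u - op_fun T u = 0}"
  have R0: "resolvent T0 \<mu> f \<in> op_dom T" "S (resolvent T0 \<mu> f) = 0"
    "\<mu> *\<^sub>C resolvent T0 \<mu> f - op_fun T (resolvent T0 \<mu> f) = f" for f
    using resolvent_T0_iff[OF \<mu>] by blast+
  have inj: "inj_on S N"
  proof (rule inj_onI)
    fix u v assume uv: "u \<in> N" "v \<in> N" "S u = S v"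
    have "u - v = resolvent T0 \<mu> 0"
      using uv clinear_on_diff[OF T_lin, of u v] clinear_on_diff[OF S_lin, of u v]
      by (subst resolvent_T0_iff[OF \<mu>, symmetric]) (auto simp: N_def scaleC_diff_right)
    also have "\<dots> = 0" by (rule bounded_clinear_zero[OF resolvent_bounded[OF \<mu>]])
    finally show "u = v" by simp
  qed
  have "y \<in> S ` N"
  proof -
    obtain u where u: "u \<in> op_dom T" "S u = y" using S_surj by (metis UNIV_I imageE)
    define w where "w = resolvent T0 \<mu> (\<mu> *\<^sub>C u - op_fun T u)"
    have w: "w \<in> op_dom T" "S w = 0" "\<mu> *\<^sub>C w - op_fun T w = \<mu> *\<^sub>C u - op_fun T u"
      using R0 unfolding w_def by blast+
    have "op_fun T (u - w) = op_fun T u - op_fun T w" "u - w \<in> op_dom T" "S (u - w) = y"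
      using u w clinear_on_diff[OF T_lin u(1) w(1)] clinear_on_diff[OF S_lin u(1) w(1)] by auto
    moreover have "\<mu> *\<^sub>C (u - w) - (op_fun T u - op_fun T w) =
        (\<mu> *\<^sub>C u - op_fun T u) - (\<mu> *\<^sub>C w - op_fun T w)"
      by (simp add: scaleC_diff_right)
    ultimately have "u - w \<in> N" "S (u - w) = y" using w(3) by (auto simp: N_def)
    then show ?thesis by blast
  qed
  then have "D \<mu> y \<in> N" "S (D \<mu> y) = y"
    unfolding dirichlet_op_def N_def[symmetric]
    using the_inv_into_into[OF inj _ subset_refl] f_the_inv_into_f[OF inj] by blast+
  with inj show ?thesis
    by (auto simp: N_def inj_on_def)
qed

text \<open>On \<open>ker (\<mu> - T)\<close> convergence of \<open>u\<close> forces convergence of \<open>T u = \<mu> u\<close>; hence closedness of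
\<open>u \<mapsto> (T u, S u)\<close> makes the graph of \<open>D \<mu>\<close> closed.\<close>

lemma dirichlet_bounded:
  assumes \<mu>: "\<mu> \<in> resolvent_set T0"
  shows "bounded_clinear (D \<mu>)"
proof (rule bounded_clinear_closed_graph)
  have D: "D \<mu> y \<in> op_dom T" "\<mu> *\<^sub>C D \<mu> y - op_fun T (D \<mu> y) = 0" "S (D \<mu> y) = y" for y
    using dirichlet_iff[OF \<mu>] by blast+
  have TD: "op_fun T (D \<mu> y) = \<mu> *\<^sub>C D \<mu> y" for y using D(2) by (metis eq_iff_diff_eq_0)
  show "D \<mu> (x + y) = D \<mu> x + D \<mu> y" for x y
    by (rule sym, rule dirichlet_iff[OF \<mu>, THEN iffD1])
      (use D TD clinear_on_add[OF T_lin D(1) D(1), of x y] clinear_on_add[OF S_lin D(1) D(1), of x y]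
        in \<open>auto simp: scaleC_add_right\<close>)
  show "D \<mu> (c *\<^sub>C x) = c *\<^sub>C D \<mu> x" for c x
    by (rule sym, rule dirichlet_iff[OF \<mu>, THEN iffD1])
      (use D TD clinear_on_scaleC[OF T_lin D(1), of c x] clinear_on_scaleC[OF S_lin D(1), of c x]
        in \<open>auto simp: scaleC_left_commute[of \<mu> c]\<close>)
  fix Y y u assume Y: "Y \<longlonglongrightarrow> y" and DY: "(\<lambda>n. D \<mu> (Y n)) \<longlonglongrightarrow> u"
  have "(\<lambda>n. (D \<mu> (Y n), op_fun T (D \<mu> (Y n)), S (D \<mu> (Y n)))) \<longlonglongrightarrow> (u, \<mu> *\<^sub>C u, y)"
    using Y DY tendsto_scaleC[OF DY, of \<mu>] by (auto simp: TD D(3) intro!: tendsto_Pair)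
  then have "(u, \<mu> *\<^sub>C u, y) \<in> {(x, op_fun T x, S x) | x. x \<in> op_dom T}"
    by (rule closed_sequentially[OF closed[unfolded closed_op_def, simplified], rotated])
      (use D(1) in auto)
  then show "D \<mu> y = u" using dirichlet_iff[OF \<mu>, of u y] by auto
qed

lemma decomposition_iff:
  assumes \<mu>: "\<mu> \<in> resolvent_set T0"
  shows "u \<in> op_dom T \<and> \<mu> *\<^sub>C u - op_fun T u = f \<and> S u = x \<longleftrightarrow> u = resolvent T0 \<mu> f + D \<mu> x"
proof -
  have R0: "resolvent T0 \<mu> f \<in> op_dom T" "S (resolvent T0 \<mu> f) = 0"
    "\<mu> *\<^sub>C resolvent T0 \<mu> f - op_fun T (resolvent T0 \<mu> f) = f"
    using resolvent_T0_iff[OF \<mu>] by blast+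
  have D: "D \<mu> x \<in> op_dom T" "\<mu> *\<^sub>C D \<mu> x - op_fun T (D \<mu> x) = 0" "S (D \<mu> x) = x"
    using dirichlet_iff[OF \<mu>] by blast+
  show ?thesis
  proof
    assume u: "u \<in> op_dom T \<and> \<mu> *\<^sub>C u - op_fun T u = f \<and> S u = x"
    then have "u - D \<mu> x = resolvent T0 \<mu> f"
      using D clinear_on_diff[OF T_lin _ D(1), of u] clinear_on_diff[OF S_lin _ D(1), of u]
      by (subst resolvent_T0_iff[OF \<mu>, symmetric]) (auto simp: scaleC_diff_right algebra_simps)
    then show "u = resolvent T0 \<mu> f + D \<mu> x" by (simp add: algebra_simps)
  next
    assume "u = resolvent T0 \<mu> f + D \<mu> x"
    then show "u \<in> op_dom T \<and> \<mu> *\<^sub>C u - op_fun T u = f \<and> S u = x"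
      using R0 D clinear_on_add[OF T_lin R0(1) D(1)] clinear_on_add[OF S_lin R0(1) D(1)]
      by (auto simp: scaleC_add_right algebra_simps)
  qed
qed

text \<open>Splitting \<open>u\<close> into its part in \<open>ker S\<close> and its part in \<open>ker (\<mu> - T)\<close> reduces the coupled resolvent
equation to an equation for the boundary value \<open>x\<close> alone. Every spectral statement about the
coupled operator is read off from this equivalence.\<close>

lemma coupled_equation_iff:
  assumes \<mu>: "\<mu> \<in> resolvent_set T0"
  shows "(u, x) \<in> op_dom coupled_op \<and> \<mu> *\<^sub>C (u, x) - op_fun coupled_op (u, x) = (f, y) \<longleftrightarrow>
    u = resolvent T0 \<mu> f + D \<mu> x \<and> \<mu> *\<^sub>C x - feedback \<mu> x = y + B (resolvent T0 \<mu> f)"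
proof -
  have "(u, x) \<in> op_dom coupled_op \<and> \<mu> *\<^sub>C (u, x) - op_fun coupled_op (u, x) = (f, y) \<longleftrightarrow>
      (u \<in> op_dom T \<and> \<mu> *\<^sub>C u - op_fun T u = f \<and> S u = x) \<and> \<mu> *\<^sub>C x - (B u + C x) = y"
    by (auto simp: block_op_def scaleC_prod_def)
  also have "\<dots> \<longleftrightarrow> u = resolvent T0 \<mu> f + D \<mu> x \<and> \<mu> *\<^sub>C x - (B u + C x) = y"
    by (subst decomposition_iff[OF \<mu>]) (rule refl)
  also have "\<dots> \<longleftrightarrow> u = resolvent T0 \<mu> f + D \<mu> x \<and> \<mu> *\<^sub>C x - feedback \<mu> x = y + B (resolvent T0 \<mu> f)"
    by (auto simp: bounded_clinear_add[OF B] algebra_simps)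
  finally show ?thesis .
qed

lemma coupled_resolvent:
  assumes \<mu>: "\<mu> \<in> resolvent_set T0" and \<mu>F: "\<mu> \<in> resolvent_set (total_op (feedback \<mu>))"
  defines "RF \<equiv> resolvent (total_op (feedback \<mu>)) \<mu>" and "R0 \<equiv> resolvent T0 \<mu>"
  shows "\<mu> \<in> resolvent_set coupled_op"
    and "resolvent coupled_op \<mu> =
      block_op (\<lambda>f. R0 f + D \<mu> (RF (B (R0 f)))) (D \<mu> \<circ> RF) (RF \<circ> B \<circ> R0) RF" (is "_ = ?G")
proof -
  have R0: "bounded_clinear R0" and RF: "bounded_clinear RF"
    unfolding R0_def RF_def using \<mu> \<mu>F by (simp_all add: resolvent_bounded)
  note Dl = dirichlet_bounded[OF \<mu>]
  have G: "?G = (\<lambda>p. (R0 (fst p) + D \<mu> (RF (snd p + B (R0 (fst p)))), RF (snd p + B (R0 (fst p)))))"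
    by (auto simp: block_op_def bounded_clinear_add[OF RF] bounded_clinear_add[OF Dl] algebra_simps)
  have "bounded_clinear ?G"
    unfolding G
    by (intro bounded_clinear_Pair bounded_clinear_plus
        bounded_clinear_compose[OF R0] bounded_clinear_compose[OF RF]
        bounded_clinear_compose[OF Dl] bounded_clinear_compose[OF B]
        bounded_clinear_fst bounded_clinear_snd)
  moreover have "p \<in> op_dom coupled_op \<and> \<mu> *\<^sub>C p - op_fun coupled_op p = q \<longleftrightarrow> p = ?G q" for p q
  proof -
    obtain u x f y where pq: "p = (u, x)" "q = (f, y)" by fastforce
    have "p \<in> op_dom coupled_op \<and> \<mu> *\<^sub>C p - op_fun coupled_op p = q \<longleftrightarrow>
        u = R0 f + D \<mu> x \<and> \<mu> *\<^sub>C x - feedback \<mu> x = y + B (R0 f)"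
      unfolding pq R0_def by (rule coupled_equation_iff[OF \<mu>])
    also have "\<mu> *\<^sub>C x - feedback \<mu> x = y + B (R0 f) \<longleftrightarrow> x = RF (y + B (R0 f))"
      using resolvent_equation_iff[OF \<mu>F, of x "y + B (R0 f)"] by (simp add: RF_def)
    also have "u = R0 f + D \<mu> x \<and> x = RF (y + B (R0 f)) \<longleftrightarrow> p = ?G q"
      by (auto simp: pq G)
    finally show ?thesis .
  qed
  ultimately show "\<mu> \<in> resolvent_set coupled_op" "resolvent coupled_op \<mu> = ?G"
    by (rule resolvent_eqI)+
qed

text \<open>The lower right block of the resolvent of the coupled operator inverts \<open>\<mu> - feedback \<mu>\<close>: for
\<open>f = 0\<close> the reduced equation is exactly \<open>\<mu> x - feedback \<mu> x = y\<close>.\<close>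

lemma feedback_resolvent:
  assumes \<mu>: "\<mu> \<in> resolvent_set T0" and \<mu>A: "\<mu> \<in> resolvent_set coupled_op"
  shows "\<mu> \<in> resolvent_set (total_op (feedback \<mu>))"
proof (rule resolvent_eqI(1))
  show "bounded_clinear (\<lambda>y. snd (resolvent coupled_op \<mu> (0, y)))"
    by (rule bounded_clinear_compose[OF bounded_clinear_snd]
        bounded_clinear_compose[OF resolvent_bounded[OF \<mu>A]] bounded_clinear_Pair_zero)+
  fix x y
  have "x = snd (resolvent coupled_op \<mu> (0, y)) \<longleftrightarrow> (\<exists>u. (u, x) = resolvent coupled_op \<mu> (0, y))"
    by (cases "resolvent coupled_op \<mu> (0, y)") auto
  also have "\<dots> \<longleftrightarrow> \<mu> *\<^sub>C x - feedback \<mu> x = y"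
    unfolding resolvent_equation_iff[OF \<mu>A, symmetric] coupled_equation_iff[OF \<mu>]
    by (simp add: bounded_clinear_zero[OF resolvent_bounded[OF \<mu>]] bounded_clinear_zero[OF B])
  finally show "x \<in> op_dom (total_op (feedback \<mu>)) \<and> \<mu> *\<^sub>C x - op_fun (total_op (feedback \<mu>)) x = y
      \<longleftrightarrow> x = snd (resolvent coupled_op \<mu> (0, y))" by simp
qed

lemma coupled_point_spectrum_iff:
  assumes \<mu>: "\<mu> \<in> resolvent_set T0"
  shows "\<mu> \<in> point_spectrum coupled_op \<longleftrightarrow> \<mu> \<in> point_spectrum (total_op (feedback \<mu>))"
proof -
  have z: "resolvent T0 \<mu> 0 = 0" "D \<mu> 0 = 0" "B 0 = 0"
    using bounded_clinear_zero resolvent_bounded[OF \<mu>] dirichlet_bounded[OF \<mu>] B by blast+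
  have eig: "(u, x) \<in> op_dom coupled_op \<and> op_fun coupled_op (u, x) = \<mu> *\<^sub>C (u, x) \<longleftrightarrow>
      u = D \<mu> x \<and> feedback \<mu> x = \<mu> *\<^sub>C x" for u x
    using coupled_equation_iff[OF \<mu>, of u x 0 0] unfolding z zero_prod_def[symmetric]
    by (auto simp: eq_commute[of "op_fun _ _"] eq_commute[of "feedback \<mu> x"])
  have pair: "(D \<mu> x, x) \<noteq> 0 \<longleftrightarrow> x \<noteq> 0" for x by (auto simp: z zero_prod_def)
  have "\<mu> \<in> point_spectrum coupled_op \<longleftrightarrow>
      (\<exists>u x. (u, x) \<noteq> 0 \<and> (u, x) \<in> op_dom coupled_op \<and> op_fun coupled_op (u, x) = \<mu> *\<^sub>C (u, x))"
    unfolding point_spectrum_def by (auto simp del: partial_op.sel)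
  also have "\<dots> \<longleftrightarrow> (\<exists>x. x \<noteq> 0 \<and> feedback \<mu> x = \<mu> *\<^sub>C x)"
    unfolding eig using pair by metis
  finally show ?thesis by (simp add: point_spectrum_def)
qed

end

section \<open>The second order problem with dynamic boundary conditions\<close>

locale second_order_boundary_problem =
  fixes j :: "'y::complex_banach \<Rightarrow> 'x::complex_banach"
    and A :: "('y, 'x) partial_op"
    and R :: "'y \<Rightarrow> 'd::complex_banach"
    and B1 B2 :: "'y \<Rightarrow> 'd"
    and B3 B4 :: "'d \<Rightarrow> 'd"
  assumes embedding: "bounded_clinear j" "inj j"
    and A_linear: "clinear_on (op_dom A) (op_fun A)"
    and R_linear: "clinear_on (op_dom A) R"
    and R_surj: "R ` op_dom A = UNIV"
    and B_bounded: "bounded_clinear B1" "bounded_clinear B2"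
      "bounded_clinear B3" "bounded_clinear B4"
    and AR_closed: "closed_op (Op (op_dom A) (\<lambda>u. (op_fun A u, R u)))"
    and A0_cosine: "generates_cosine_function j (restrict_ker A R)"
begin

lemma inv_j [simp]: "inv j (j v) = v"
  using embedding(2) by (rule inv_f_f)

lemma bb_A_simps:
  "op_dom (bb_A j A R B2) = op_dom A \<times> range j \<times> UNIV"
  "op_fun (bb_A j A R B2) (u, w, x) = (inv j w, op_fun A u, R u + B2 u)"
  by (simp_all add: bb_A_def)

text \<open>Convergence of the first component \<open>v\<close> of the image in \<open>Y\<close> gives convergence of \<open>w = j v\<close> in \<open>X\<close>,
and the third component is determined by \<open>R u\<close> and the bounded \<open>B2\<close>; what remains is closedness
of \<open>u \<mapsto> (A u, R u)\<close>.\<close>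

lemma bb_A_graph_closed:
  "closed_op (Op (op_dom (bb_A j A R B2)) (\<lambda>p. (op_fun (bb_A j A R B2) p, bb_R R p)))"
  unfolding closed_op_def closed_sequential_limits partial_op.sel
proof (intro allI impI, elim conjE)
  fix q l
  assume q: "\<forall>n. q n \<in> {(p, op_fun (bb_A j A R B2) p, bb_R R p) | p. p \<in> op_dom (bb_A j A R B2)}"
    and lim: "q \<longlonglongrightarrow> l"
  define u where "u n = fst (fst (q n))" for n
  define x where "x n = snd (snd (fst (q n)))" for n
  define v where "v n = fst (fst (snd (q n)))" for n
  have qn: "u n \<in> op_dom A \<and> q n = ((u n, j (v n), x n), (v n, op_fun A (u n), R (u n) + B2 (u n)), R (u n))" for n
    using q[rule_format, of n] by (auto simp: u_def x_def v_def bb_A_def bb_R_def)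
  then have u: "\<And>n. u n \<in> op_dom A" by blast
  have q_eq: "q = (\<lambda>n. ((u n, j (v n), x n), (v n, op_fun A (u n), R (u n) + B2 (u n)), R (u n)))"
    using qn by blast
  obtain u' w' x' v' g' l' r' where l: "l = ((u', w', x'), (v', g', l'), r')"
    by (metis prod.collapse)
  have lims: "u \<longlonglongrightarrow> u'" "(\<lambda>n. j (v n)) \<longlonglongrightarrow> w'" "v \<longlonglongrightarrow> v'" "(\<lambda>n. op_fun A (u n)) \<longlonglongrightarrow> g'"
    "(\<lambda>n. R (u n) + B2 (u n)) \<longlonglongrightarrow> l'" "(\<lambda>n. R (u n)) \<longlonglongrightarrow> r'"
    using tendsto_fst[OF tendsto_fst[OF lim]] tendsto_fst[OF tendsto_snd[OF tendsto_fst[OF lim]]]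
      tendsto_fst[OF tendsto_fst[OF tendsto_snd[OF lim]]]
      tendsto_fst[OF tendsto_snd[OF tendsto_fst[OF tendsto_snd[OF lim]]]]
      tendsto_snd[OF tendsto_snd[OF tendsto_fst[OF tendsto_snd[OF lim]]]]
      tendsto_snd[OF tendsto_snd[OF lim]]
    by (simp_all add: q_eq l)
  have "(u', g', r') \<in> {(z, op_fun A z, R z) | z. z \<in> op_dom A}"
    by (rule closed_sequentially[OF AR_closed[unfolded closed_op_def, simplified],
          of "\<lambda>n. (u n, op_fun A (u n), R (u n))"])
      (use u lims in \<open>auto intro!: tendsto_Pair\<close>)
  then have u': "u' \<in> op_dom A" "op_fun A u' = g'" "R u' = r'" by auto
  have "(\<lambda>n. j (v n)) \<longlonglongrightarrow> j v'"
    using bounded_linear.tendsto[OF bounded_clinear_imp_bounded_linear[OF embedding(1)] lims(3)] .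
  then have w': "w' = j v'" using lims(2) LIMSEQ_unique by blast
  have "(\<lambda>n. R (u n) + B2 (u n)) \<longlonglongrightarrow> r' + B2 u'"
    using tendsto_add[OF lims(6) bounded_linear.tendsto[OF
          bounded_clinear_imp_bounded_linear[OF B_bounded(2)] lims(1)]] .
  then have l': "l' = r' + B2 u'" using lims(5) LIMSEQ_unique by blast
  show "l \<in> {(p, op_fun (bb_A j A R B2) p, bb_R R p) | p. p \<in> op_dom (bb_A j A R B2)}"
    using u' by (auto simp: l w' l' bb_A_def bb_R_def)
qed

sublocale boundary_coupling "bb_A j A R B2" "bb_R R" "bb_B B1 B2 B3 B4" B4
proof
  have zero: "0 \<in> op_dom A" using clinear_on_zero[OF A_linear] by blast
  have sub: "csubspace (op_dom (bb_A j A R B2))"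
    unfolding csubspace_def
  proof (intro conjI ballI allI)
    show "0 \<in> op_dom (bb_A j A R B2)"
      using zero rangeI[of j 0] bounded_clinear_zero[OF embedding(1)]
      by (simp add: bb_A_simps zero_prod_def)
  next
    fix p q assume "p \<in> op_dom (bb_A j A R B2)" "q \<in> op_dom (bb_A j A R B2)"
    then show "p + q \<in> op_dom (bb_A j A R B2)"
      using clinear_on_add[OF A_linear] by (auto simp: bb_A_simps simp flip: bounded_clinear_add[OF embedding(1)])
  next
    fix p c assume "p \<in> op_dom (bb_A j A R B2)"
    then show "c *\<^sub>C p \<in> op_dom (bb_A j A R B2)"
      using clinear_on_scaleC[OF A_linear]
      by (auto simp: bb_A_simps scaleC_prod_def simp flip: bounded_clinear_scaleC[OF embedding(1)])
  qed
  show "clinear_on (op_dom (bb_A j A R B2)) (op_fun (bb_A j A R B2))"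
    unfolding clinear_on_def
    using sub clinear_on_add[OF A_linear] clinear_on_scaleC[OF A_linear]
      clinear_on_add[OF R_linear] clinear_on_scaleC[OF R_linear]
    by (auto simp: bb_A_simps scaleC_prod_def scaleC_add_right
        bounded_clinear_add[OF B_bounded(2)] bounded_clinear_scaleC[OF B_bounded(2)]
        simp flip: bounded_clinear_add[OF embedding(1)] bounded_clinear_scaleC[OF embedding(1)])
  show "clinear_on (op_dom (bb_A j A R B2)) (bb_R R)"
    unfolding clinear_on_def
    using sub clinear_on_add[OF R_linear] clinear_on_scaleC[OF R_linear]
    by (auto simp: bb_A_simps bb_R_def scaleC_prod_def)
  show "bb_R R ` op_dom (bb_A j A R B2) = UNIV"
  proof (rule UNIV_eq_I[symmetric])
    fix y
    obtain u where "u \<in> op_dom A" "R u = y" using R_surj by (metis UNIV_I imageE)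
    then show "y \<in> bb_R R ` op_dom (bb_A j A R B2)"
      by (intro image_eqI[of _ _ "(u, j 0, 0)"]) (auto simp: bb_A_simps bb_R_def)
  qed
  show "bounded_clinear (bb_B B1 B2 B3 B4 :: 'y \<times> 'x \<times> 'd \<Rightarrow> 'd)"
  proof -
    have eq: "(bb_B B1 B2 B3 B4 :: 'y \<times> 'x \<times> 'd \<Rightarrow> 'd) = (\<lambda>p. (B1 (fst p) + B4 (B2 (fst p))) + B3 (snd (snd p)))"
      by (auto simp: bb_B_def)
    show ?thesis
      unfolding eq
      by (intro bounded_clinear_plus bounded_clinear_compose[OF B_bounded(1)]
          bounded_clinear_compose[OF B_bounded(2)] bounded_clinear_compose[OF B_bounded(3)]
          bounded_clinear_compose[OF B_bounded(4)] bounded_clinear_compose[OF bounded_clinear_snd]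
          bounded_clinear_fst bounded_clinear_snd)
  qed
qed (fact bb_A_graph_closed B_bounded)+

abbreviation "phase_op \<equiv> phase_space_op j (restrict_ker A R)"

text \<open>On \<open>ker R\<close> the operator on \<open>Y \<times> X \<times> \<partial>X\<close> is triangular: its first two components form the phase
space operator, and the third equation \<open>l x - B2 u = z\<close> is solved by division by \<open>l\<close>.\<close>

lemma resolvent_set_T0_if_phase_space:
  assumes l: "0 < l"
    and ex: "\<And>f. \<exists>p\<in>op_dom phase_op. l *\<^sub>R p - op_fun phase_op p = f"
    and est: "\<And>p. p \<in> op_dom phase_op \<Longrightarrow> norm p \<le> K * norm (l *\<^sub>R p - op_fun phase_op p)"
    and K: "0 \<le> K"
  shows "complex_of_real l \<in> resolvent_set T0"
proof -
  obtain b where b: "0 \<le> b" "\<And>u. norm (B2 u) \<le> b * norm u"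
    using bounded_clinear_bound[OF B_bounded(2)] by blast
  show ?thesis
  proof (rule resolvent_setI)
    show "clinear_on (op_dom T0) (op_fun T0)"
      using T_lin S_lin clinear_on_zero[OF S_lin] by (auto simp: clinear_on_def csubspace_def restrict_ker_def)
  next
    fix y :: "'y \<times> 'x \<times> 'd"
    obtain f g z where y: "y = (f, g, z)" by (metis prod.collapse)
    from ex[of "(f, g)"] obtain u v where uv: "u \<in> op_dom A" "R u = 0"
      "l *\<^sub>R u - v = f" "l *\<^sub>R j v - op_fun A u = g"
      by (fastforce simp: phase_space_op_def restrict_ker_def)
    have "l *\<^sub>R ((1 / l) *\<^sub>R (z + B2 u)) - B2 u = z" using l by simp
    then show "\<exists>p\<in>op_dom T0. complex_of_real l *\<^sub>C p - op_fun T0 p = y"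
      using uv
      by (intro bexI[of _ "(u, j v, (1 / l) *\<^sub>R (z + B2 u))"])
        (auto simp: restrict_ker_def bb_A_simps bb_R_def scaleC_of_real y)
  next
    fix p assume p: "p \<in> op_dom T0"
    then obtain u v x where p_eq: "p = (u, j v, x)" and u: "u \<in> op_dom A" "R u = 0"
      by (auto simp: restrict_ker_def bb_A_simps bb_R_def)
    define q where "q = complex_of_real l *\<^sub>C p - op_fun T0 p"
    define f where "f = l *\<^sub>R u - v"
    define g where "g = l *\<^sub>R j v - op_fun A u"
    have q: "q = (f, g, l *\<^sub>R x - B2 u)"
      using u by (simp add: q_def f_def g_def p_eq restrict_ker_def bb_A_simps scaleC_of_real)
    have N: "norm f \<le> norm q" "norm g \<le> norm q" "norm (l *\<^sub>R x - B2 u) \<le> norm q"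
      using norm_fst_le[of f] norm_snd_le[of "(g, l *\<^sub>R x - B2 u)" f]
        norm_fst_le[of g "l *\<^sub>R x - B2 u"] norm_snd_le[of "l *\<^sub>R x - B2 u" g]
      unfolding q by auto
    have "norm (u, j v) \<le> K * norm (f, g)"
      using est[of "(u, j v)"] u by (simp add: phase_space_op_def restrict_ker_def f_def g_def)
    also have "\<dots> \<le> K * (2 * norm q)"
      using norm_Pair_le[of f g] N by (intro mult_left_mono K) auto
    finally have uv: "norm u \<le> 2 * K * norm q" "norm (j v) \<le> 2 * K * norm q"
      using norm_fst_le[of u "j v"] norm_snd_le[of "j v" u] by auto
    have "l * norm x = norm (l *\<^sub>R x)" using l by simp
    also have "\<dots> \<le> norm (l *\<^sub>R x - B2 u) + norm (B2 u)"
      using norm_triangle_ineq[of "l *\<^sub>R x - B2 u" "B2 u"] by simp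
    also have "\<dots> \<le> norm q + b * (2 * K * norm q)"
      using N(3) order_trans[OF b(2)[of u] mult_left_mono[OF uv(1) b(1)]] by simp
    finally have x: "norm x \<le> (1 + b * (2 * K)) / l * norm q"
      using l by (simp add: field_simps)
    have "norm p \<le> norm u + (norm (j v) + norm x)"
      using norm_Pair_le[of u "(j v, x)"] norm_Pair_le[of "j v" x] unfolding p_eq by linarith
    then show "norm p \<le> (4 * K + (1 + b * (2 * K)) / l) * norm q"
      using uv x by (simp add: algebra_simps)
  qed
qed

text \<open>The difference \<open>u - u0\<close> of
the solutions at \<open>l\<close> and \<open>l0\<close> with the same boundary value lies in \<open>ker R\<close> and satisfies
\<open>l\<^sup>2 j (u - u0) - A (u - u0) = (l0\<^sup>2 - l\<^sup>2) j u0\<close>. The factor \<open>l\<^sup>2\<close> on the right would be too large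
in \<open>X\<close>; but \<open>u0\<close> lies in \<open>Y\<close>, so the right-hand side can be moved to the first component of the
phase space equation, which costs one power of \<open>l\<close> less. The decay \<open>M / l\<close> absorbs the rest.\<close>

lemma dirichlet_fst_bound:
  assumes l0: "0 < l0" "l0 \<le> l"
    and \<rho>: "complex_of_real l0 \<in> resolvent_set T0" "complex_of_real l \<in> resolvent_set T0"
    and est: "\<And>p. p \<in> op_dom phase_op \<Longrightarrow> norm p \<le> M / l * norm (l *\<^sub>R p - op_fun phase_op p)"
    and M: "0 \<le> M"
  shows "norm (fst (D (complex_of_real l) y)) \<le> (1 + M) * norm (fst (D (complex_of_real l0) y))"
proof -
  have comp: "\<exists>u x. D (complex_of_real k) y = (u, j (k *\<^sub>R u), x) \<and> u \<in> op_dom A \<and> R u = y \<and>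
      op_fun A u = k\<^sup>2 *\<^sub>R j u" if "complex_of_real k \<in> resolvent_set T0" for k
  proof -
    obtain u w x where D: "D (complex_of_real k) y = (u, w, x)" by (metis prod.collapse)
    have "(u, w, x) \<in> op_dom (bb_A j A R B2) \<and>
        complex_of_real k *\<^sub>C (u, w, x) - op_fun (bb_A j A R B2) (u, w, x) = 0 \<and> bb_R R (u, w, x) = y"
      using dirichlet_iff[OF that, of "(u, w, x)" y] D by simp
    then obtain v where v: "u \<in> op_dom A" "w = j v" "R u = y" "k *\<^sub>R u - v = 0" "k *\<^sub>R w - op_fun A u = 0"
      by (auto simp: bb_A_simps bb_R_def scaleC_of_real zero_prod_def)
    have "j (k *\<^sub>R u) = k *\<^sub>R j u"
      by (rule linear_scale[OF bounded_linear.linear[OF bounded_clinear_imp_bounded_linear[OF embedding(1)]]])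
    with D v show ?thesis by (auto simp: power2_eq_square)
  qed
  note j_lin = linear_simps[OF bounded_clinear_imp_bounded_linear[OF embedding(1)]]
  have l: "l > 0" using l0 by simp
  obtain u x where u: "D (complex_of_real l) y = (u, j (l *\<^sub>R u), x)" "u \<in> op_dom A" "R u = y"
    "op_fun A u = l\<^sup>2 *\<^sub>R j u" using comp[OF \<rho>(2)] by blast
  obtain u0 x0 where u0: "D (complex_of_real l0) y = (u0, j (l0 *\<^sub>R u0), x0)" "u0 \<in> op_dom A" "R u0 = y"
    "op_fun A u0 = l0\<^sup>2 *\<^sub>R j u0" using comp[OF \<rho>(1)] by blast
  \<comment> \<open>second component chosen so that the phase space residual vanishes in \<open>X\<close>\<close>
  define w where "w = l *\<^sub>R u - (l0\<^sup>2 / l) *\<^sub>R u0"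
  have p: "(u - u0, j w) \<in> op_dom phase_op"
    using u u0 clinear_on_diff[OF A_linear u(2) u0(2)] clinear_on_diff[OF R_linear u(2) u0(2)]
    by (simp add: phase_space_op_def restrict_ker_def)
  have "op_fun A (u - u0) = l *\<^sub>R j w"
    using l clinear_on_diff[OF A_linear u(2) u0(2)] u(4) u0(4)
    by (simp add: w_def j_lin scaleR_diff_right power2_eq_square)
  then have "l *\<^sub>R (u - u0, j w) - op_fun phase_op (u - u0, j w) = (l *\<^sub>R (u - u0) - w, 0)"
    by (simp add: phase_space_op_def restrict_ker_def)
  also have "l *\<^sub>R (u - u0) - w = - ((l - l0\<^sup>2 / l) *\<^sub>R u0)"
    by (simp add: w_def algebra_simps)
  finally have "norm (u - u0, j w) \<le> M / l * (\<bar>l - l0\<^sup>2 / l\<bar> * norm u0)"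
    using est[OF p] by (simp add: norm_Pair)
  also have "\<dots> \<le> M / l * (l * norm u0)"
  proof -
    have "l0\<^sup>2 \<le> l\<^sup>2" using l0 by (intro power_mono) auto
    then have "0 \<le> l - l0\<^sup>2 / l" "l0\<^sup>2 / l \<ge> 0" using l by (auto simp: field_simps power2_eq_square)
    then have "\<bar>l - l0\<^sup>2 / l\<bar> \<le> l" by simp
    then show ?thesis using M l by (intro mult_left_mono mult_right_mono) auto
  qed
  also have "\<dots> = M * norm u0" using l by simp
  finally have "norm (u - u0) \<le> M * norm u0"
    using norm_fst_le[of "u - u0" "j w"] by simp
  then have "norm u \<le> (1 + M) * norm u0"
    using norm_triangle_ineq[of "u - u0" u0] by (simp add: algebra_simps)
  then show ?thesis by (simp add: u(1) u0(1))
qed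

text \<open>The feedback operators stay bounded along the real axis: \<open>feedback l\<close> sees only the first and
third components of the Dirichlet operator, the former being bounded uniformly in \<open>l\<close> and the
latter being \<open>(y + B2 u) / l\<close>. A real \<open>l\<close> beyond the common bound then lies in both resolvent sets.\<close>

lemma exists_in_both_resolvent_sets:
  "\<exists>\<mu>. \<mu> \<in> resolvent_set T0 \<and> \<mu> \<in> resolvent_set (total_op (feedback \<mu>))"
proof -
  obtain M l0 where M: "0 < M" and l0: "0 < l0"
    and ex: "\<And>l f. l0 \<le> l \<Longrightarrow> \<exists>p\<in>op_dom phase_op. l *\<^sub>R p - op_fun phase_op p = f"
    and est: "\<And>l p. l0 \<le> l \<Longrightarrow> p \<in> op_dom phase_op \<Longrightarrow>
        norm p \<le> M / l * norm (l *\<^sub>R p - op_fun phase_op p)"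
    using generator_resolvent_estimate A0_cosine unfolding generates_cosine_function_def by blast
  have \<rho>: "complex_of_real l \<in> resolvent_set T0" if "l0 \<le> l" for l
    using that l0 M by (intro resolvent_set_T0_if_phase_space[OF _ ex[OF that] est[OF that]]) auto
  obtain c where c: "0 \<le> c" "\<And>y. norm (D (complex_of_real l0) y) \<le> c * norm y"
    using bounded_clinear_bound[OF dirichlet_bounded[OF \<rho>[OF order_refl]]] by blast
  obtain b1 where b1: "0 \<le> b1" "\<And>u. norm (B1 u) \<le> b1 * norm u"
    using bounded_clinear_bound[OF B_bounded(1)] by blast
  obtain b2 where b2: "0 \<le> b2" "\<And>u. norm (B2 u) \<le> b2 * norm u"
    using bounded_clinear_bound[OF B_bounded(2)] by blast
  obtain b3 where b3: "0 \<le> b3" "\<And>u. norm (B3 u) \<le> b3 * norm u"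
    using bounded_clinear_bound[OF B_bounded(3)] by blast
  obtain b4 where b4: "0 \<le> b4" "\<And>u. norm (B4 u) \<le> b4 * norm u"
    using bounded_clinear_bound[OF B_bounded(4)] by blast
  define k where "k = (1 + M) * c"
  define h where "h = (1 + b2 * k) / l0"
  define C where "C = b4 + (b1 * k + b4 * (b2 * k)) + b3 * h"
  have nn: "0 \<le> k" "0 \<le> h" "0 \<le> C"
    using M c b1 b2 b3 b4 l0 by (simp_all add: k_def h_def C_def)
  have bound: "norm (feedback (complex_of_real l) y) \<le> C * norm y" if l: "l0 \<le> l" for l y
  proof -
    obtain u w x where D: "D (complex_of_real l) y = (u, w, x)" by (metis prod.collapse)
    have "(u, w, x) \<in> op_dom (bb_A j A R B2) \<and>
        complex_of_real l *\<^sub>C (u, w, x) - op_fun (bb_A j A R B2) (u, w, x) = 0 \<and> bb_R R (u, w, x) = y"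
      using dirichlet_iff[OF \<rho>[OF l], of "(u, w, x)" y] D by simp
    then have x_eq: "l *\<^sub>R x = y + B2 u"
      by (auto simp: bb_A_simps bb_R_def scaleC_of_real zero_prod_def)
    have "norm u \<le> (1 + M) * norm (fst (D (complex_of_real l0) y))"
      using dirichlet_fst_bound[OF l0 l \<rho>[OF order_refl] \<rho>[OF l] est[OF l], of y] M D by simp
    also have "\<dots> \<le> (1 + M) * (c * norm y)"
      using norm_fst_le[of "fst (D (complex_of_real l0) y)" "snd (D (complex_of_real l0) y)"]
        c(2)[of y] M by (intro mult_left_mono) auto
    finally have u: "norm u \<le> k * norm y" by (simp add: k_def mult.assoc)
    have B2u: "norm (B2 u) \<le> b2 * (k * norm y)"
      using order_trans[OF b2(2) mult_left_mono[OF u b2(1)]] .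
    have "l0 * norm x \<le> l * norm x" using l by (intro mult_right_mono) auto
    also have "\<dots> = norm (y + B2 u)" using l l0 by (simp flip: x_eq)
    also have "\<dots> \<le> norm y + b2 * (k * norm y)" using norm_triangle_ineq[of y "B2 u"] B2u by simp
    finally have x: "norm x \<le> h * norm y" using l0 by (simp add: h_def field_simps)
    have "feedback (complex_of_real l) y = B4 y + ((B1 u + B4 (B2 u)) + B3 x)"
      by (simp add: D bb_B_def)
    also have "norm \<dots> \<le> norm (B4 y) + ((norm (B1 u) + norm (B4 (B2 u))) + norm (B3 x))"
      by (intro order_trans[OF norm_triangle_ineq] add_mono order_refl norm_triangle_ineq)
    also have "\<dots> \<le> b4 * norm y + ((b1 * (k * norm y) + b4 * (b2 * (k * norm y))) + b3 * (h * norm y))"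
      using order_trans[OF b1(2) mult_left_mono[OF u b1(1)]]
        order_trans[OF b4(2) mult_left_mono[OF B2u b4(1)]]
        order_trans[OF b3(2) mult_left_mono[OF x b3(1)]] b4(2)[of y]
      by (intro add_mono) auto
    also have "\<dots> = C * norm y" by (simp add: C_def algebra_simps)
    finally show ?thesis .
  qed
  define l where "l = max l0 (C + 1)"
  have l: "l0 \<le> l" "C < l" by (simp_all add: l_def)
  have "bounded_clinear (feedback (complex_of_real l))"
    by (intro bounded_clinear_plus C bounded_clinear_compose[OF B] dirichlet_bounded \<rho> l)
  then have "complex_of_real l \<in> resolvent_set (total_op (feedback (complex_of_real l)))"
    by (rule in_resolvent_set_if_norm_less[OF _ nn(3) bound[OF l(1)] l(2)])
  then show ?thesis using \<rho>[OF l(1)] by blast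
qed

end

theorem proposition3p11:
  fixes j :: "'y::complex_banach \<Rightarrow> 'x::complex_banach"
    and A :: "('y, 'x) partial_op"
    and R :: "'y \<Rightarrow> 'd::complex_banach"
    and B1 B2 :: "'y \<Rightarrow> 'd"
    and B3 B4 :: "'d \<Rightarrow> 'd"
  assumes embedding: "bounded_clinear j" "inj j"
    and A_linear: "clinear_on (op_dom A) (op_fun A)"
    and R_linear: "clinear_on (op_dom A) R"
    and R_surj: "R ` op_dom A = UNIV"
    and B_bounded: "bounded_clinear B1" "bounded_clinear B2"
      "bounded_clinear B3" "bounded_clinear B4"
    and AR_closed: "closed_op (Op (op_dom A) (\<lambda>u. (op_fun A u, R u)))"
    and A0_cosine: "generates_cosine_function j (restrict_ker A R)"
  shows
    "(\<forall>\<mu> \<in> resolvent_set (bb_A0 j A R B2).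
        (\<mu> \<in> spectrum (cal_A j A R B1 B2 B3 B4) \<longleftrightarrow>
          \<mu> \<in> spectrum (total_op (bb_B_at j A R B1 B2 B3 B4 \<mu>))) \<and>
        (\<mu> \<in> point_spectrum (cal_A j A R B1 B2 B3 B4) \<longleftrightarrow>
          \<mu> \<in> point_spectrum (total_op (bb_B_at j A R B1 B2 B3 B4 \<mu>)))) \<and>
     Gamma_set j A R B1 B2 B3 B4 \<subseteq> resolvent_set (cal_A j A R B1 B2 B3 B4) \<and>
     Gamma_set j A R B1 B2 B3 B4 \<noteq> {} \<and>
     (\<forall>\<mu> \<in> Gamma_set j A R B1 B2 B3 B4.
        let R0 = resolvent (bb_A0 j A R B2) \<mu>;
            RB = resolvent (total_op (bb_B_at j A R B1 B2 B3 B4 \<mu>)) \<mu>;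
            BB = bb_B B1 B2 B3 B4;
            DD = bb_D j A R B2 \<mu>
        in resolvent (cal_A j A R B1 B2 B3 B4) \<mu> =
             block_op (\<lambda>f. R0 f + DD (RB (BB (R0 f)))) (DD \<circ> RB)
                      (RB \<circ> BB \<circ> R0)                   RB)"
proof -
  interpret second_order_boundary_problem j A R B1 B2 B3 B4
    by unfold_locales (fact assms)+
  have A0: "bb_A0 j A R B2 = T0" by (simp add: bb_A0_def)
  have cA: "cal_A j A R B1 B2 B3 B4 = coupled_op" by (simp add: cal_A_def)
  have F: "bb_B_at j A R B1 B2 B3 B4 \<mu> = feedback \<mu>" for \<mu> by (simp add: bb_B_at_def bb_D_def)
  have G: "Gamma_set j A R B1 B2 B3 B4 =
      {\<mu>. \<mu> \<in> resolvent_set T0 \<and> \<mu> \<in> resolvent_set (total_op (feedback \<mu>))}"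
    by (auto simp: Gamma_set_def A0 F)
  have "\<mu> \<in> spectrum coupled_op \<longleftrightarrow> \<mu> \<in> spectrum (total_op (feedback \<mu>))"
    if "\<mu> \<in> resolvent_set T0" for \<mu>
    unfolding spectrum_def using coupled_resolvent(1)[OF that] feedback_resolvent[OF that] by blast
  then show ?thesis
    unfolding A0 cA F G bb_D_def Let_def
    using coupled_point_spectrum_iff coupled_resolvent exists_in_both_resolvent_sets
    by blast
qed

end
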